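(* Assume each $f_i$ is convex and $L$-smooth, and $g$ is $\mu$-strongly convex with $0<\mu\le L$. Run the algorithm ODAPG (described in the context) with $\gamma_t=\gamma=\frac{1}{20\sqrt{L\mu}}$, $\tau_t=\tau=\mu\gamma$ and $K=\frac{15}{\sqrt{1-\lambda_2(W)}}$. Then, to find an $\epsilon$-suboptimal solution (that is, to have $\|\mathbf{z}_T^{(i)}-x^*\|^2\le\epsilon$ for every agent $i$, where $x^*$ is the minimizer of $F$), the computation complexity $T$ and the communication complexity $C$ of the algorithm for each agent are $$T=\mathcal{O}\left(\sqrt{\frac{L}{\mu}}\log\frac1\epsilon\right)\quad\text{and}\quad C=\mathcal{O}\left(\sqrt{\frac{L}{\mu(1-\lambda_2(W))}}\log\frac1\epsilon\right).$$
   Context: Problem: $f_1,\dots,f_m:\mathbb{R}^d\to\mathbb{R}$ and $g:\mathbb{R}^d\to\mathbb{R}$ (possibly non-differentiable); $f(x)=\frac1m\sum_{i=1}^m f_i(x)$, $F(x)=f(x)+g(x)$. Each agent $i\in\{1,\dots,m\}$ of a connected undirected static network holds $f_i$. "$f_i$ convex and $L$-smooth" means, for all $x,y\in\mathbb{R}^d$: $f_i(y)\ge f_i(x)+\langle\nabla f_i(x),y-x\rangle$ and $f_i(y)\le f_i(x)+\langle\nabla f_i(x),y-x\rangle+\frac L2\|x-y\|^2$. "$g$ is $\mu$-strongly convex" means $g(y)\ge g(x)+\langle\partial g(x),y-x\rangle+\frac\mu2\|y-x\|^2$ for all $x,y$ and any subgradient $\partial g(x)$ at $x$. Weight matrix: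 $W\in\mathbb{R}^{m\times m}$ is symmetric, $W_{i,j}\ne0$ iff agents $i,j$ are connected or $i=j$, $\mathbf{0}\preceq W\preceq I$, $W\mathbf{1}=\mathbf{1}$, $\mathrm{null}(I-W)=\mathrm{span}(\mathbf{1})$; $\lambda_2(W)$ is its second largest eigenvalue. Notation: vectors of $\mathbb{R}^d$ are identified with row vectors. Bold letters denote $m\times d$ matrices with $i$-th row $\mathbf{x}^{(i)}$, etc.; $\mathbf{1}\in\mathbb{R}^m$ is the all-ones vector. $\|\cdot\|$ is the Frobenius (Euclidean) norm. $\nabla\widetilde f(\mathbf{x})$ is the $m\times d$ matrix with $i$-th row $\nabla f_i(\mathbf{x}^{(i)})$. $\mathrm{prox}_{\gamma g}(\mathbf{x})$ is the $m\times d$ matrix with $i$-th row $\mathrm{argmin}_{w\in\mathbb{R}^d}\{\gamma g(w)+\frac12\|w-\mathbf{x}^{(i)}\|^2\}$. $\mathrm{FastMix}(\mathbf{x},K)$: set $\mathbf{x}^0=\mathbf{x}^1=\mathbf{x}$, $\eta_w=1/(1+\sqrt{1-\lambda_2^2(W)})$, and for $k=1,\dots,K$ let $\mathbf{x}^{k+1}=(1+\eta_w)W\mathbf{x}^k-\eta_w\mathbf{x}^{k-1}$; the output is $\mathbf{x}^K$. ($K$ is an iteration count, understood as a positive integer.) Algorithm ODAPG: given $x_1\in\mathbb{R}^d$, set $\mathbf{z}_1=\mathbf{y}_1=\mathbf{x}_1=\mathbf{1}x_1$ and $\mathbf{s}_1=\nabla\widetilde f(\mathbf{x}_1)$. For $t=1,2,\dots$: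 $\mathbf{x}_{t+1}=\tau_t\mathbf{z}_t+(1-\tau_t)\mathbf{y}_t$; $\mathbf{s}_{t+1}=\mathrm{FastMix}(\mathbf{s}_t+\nabla\widetilde f(\mathbf{x}_{t+1})-\nabla\widetilde f(\mathbf{x}_t),K)$; $\mathbf{z}_{t+1}=\mathrm{FastMix}(\mathrm{prox}_{\gamma_t g}(\mathbf{z}_t-\gamma_t\mathbf{s}_{t+1}),K)$; $\mathbf{y}_{t+1}=\mathrm{FastMix}(\tau_t\mathbf{z}_{t+1}+(1-\tau_t)\mathbf{y}_t,K)$. Complexities: the computation complexity is the number of local gradient evaluations per agent, counted as one per iteration, hence equal to the number $T$ of iterations. The communication complexity is the number of rounds of local communication, counted as $K$ per FastMix call with three FastMix calls per iteration, i.e. $C=3TK$. The $\mathcal{O}(\cdot)$ is as $\epsilon\to0$ with a universal constant factor; the threshold below which $\epsilon$ must lie may depend on the problem and the initialization (equivalently, an additive term, the logarithm of a quantity depending only on $m,L,\mu$ and the initial point, is hidden beside $\log\frac1\epsilon$). *)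

theory Defs
  imports "HOL-Analysis.Analysis" "HOL-Library.Multiset"
begin

text \<open>
  An \<open>m \<times> d\<close> matrix whose \<open>i\<close>-th row belongs to agent \<open>i\<close> is an element of \<open>real^'d^'m\<close>; the norm of
  this type is the Frobenius norm.
\<close>


subsection \<open>Functions on \<open>\<real>\<^sup>d\<close>\<close>

definition gradient :: "(real^'d \<Rightarrow> real) \<Rightarrow> real^'d \<Rightarrow> real^'d" where
  "gradient f x = (THE D. GDERIV f x :> D)"

definition convex_smooth :: "real \<Rightarrow> (real^'d \<Rightarrow> real) \<Rightarrow> bool" where
  "convex_smooth L f \<longleftrightarrow>
     (\<forall>x. \<exists>D. GDERIV f x :> D) \<and>
     (\<forall>x y. f y \<ge> f x + gradient f x \<bullet> (y - x)) \<and>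
     (\<forall>x y. f y \<le> f x + gradient f x \<bullet> (y - x) + L / 2 * (norm (x - y))\<^sup>2)"

definition subdifferential :: "(real^'d \<Rightarrow> real) \<Rightarrow> real^'d \<Rightarrow> (real^'d) set" where
  "subdifferential g x = {v. \<forall>y. g y \<ge> g x + v \<bullet> (y - x)}"

text \<open>
  Convexity is required separately: the inequality alone is vacuous at points without a subgradient.
\<close>

definition strongly_convex :: "real \<Rightarrow> (real^'d \<Rightarrow> real) \<Rightarrow> bool" where
  "strongly_convex \<mu> g \<longleftrightarrow>
     convex_on UNIV g \<and>
     (\<forall>x y. \<forall>v \<in> subdifferential g x. g y \<ge> g x + v \<bullet> (y - x) + \<mu> / 2 * (norm (y - x))\<^sup>2)"

definition prox :: "real \<Rightarrow> (real^'d \<Rightarrow> real) \<Rightarrow> real^'d \<Rightarrow> real^'d" where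
  "prox \<gamma> g v = (ARG_MIN (\<lambda>w. \<gamma> * g w + 1 / 2 * (norm (w - v))\<^sup>2) w. True)"

definition objective :: "('m::finite \<Rightarrow> real^'d \<Rightarrow> real) \<Rightarrow> (real^'d \<Rightarrow> real) \<Rightarrow> real^'d \<Rightarrow> real" where
  "objective f g x = 1 / real CARD('m) * (\<Sum>i\<in>UNIV. f i x) + g x"


subsection \<open>The network and its weight matrix\<close>

definition connected_network :: "('m \<Rightarrow> 'm \<Rightarrow> bool) \<Rightarrow> bool" where
  "connected_network adj \<longleftrightarrow> symp adj \<and> (\<forall>i j. adj\<^sup>*\<^sup>* i j)"

definition loewner_le :: "real^'m^'m \<Rightarrow> real^'m^'m \<Rightarrow> bool" where
  "loewner_le A B \<longleftrightarrow> (\<forall>v. 0 \<le> v \<bullet> ((B - A) *v v))"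

definition weight_matrix :: "('m::finite \<Rightarrow> 'm \<Rightarrow> bool) \<Rightarrow> real^'m^'m \<Rightarrow> bool" where
  "weight_matrix adj W \<longleftrightarrow>
     transpose W = W \<and>
     (\<forall>i j. W $ i $ j \<noteq> 0 \<longleftrightarrow> adj i j \<or> i = j) \<and>
     loewner_le 0 W \<and> loewner_le W (mat 1) \<and>
     W *v (\<chi> i. 1) = (\<chi> i. 1) \<and>
     {v. (mat 1 - W) *v v = 0} = span {\<chi> i. 1}"

definition eigenspace :: "real^'m^'m \<Rightarrow> real \<Rightarrow> (real^'m) set" where
  "eigenspace A l = {v. A *v v = l *\<^sub>R v}"

text \<open>
  Eigenvalues are counted with geometric multiplicity, which for the symmetric matrices considered
  here is the same as algebraic multiplicity.
\<close>

definition eigenvalue_mset :: "real^'m^'m \<Rightarrow> real multiset" where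
  "eigenvalue_mset A =
     (\<Sum>l\<in>{l. eigenspace A l \<noteq> {0}}. replicate_mset (dim (eigenspace A l)) l)"

definition lambda2 :: "real^'m^'m \<Rightarrow> real" where
  "lambda2 A = rev (sorted_list_of_multiset (eigenvalue_mset A)) ! 1"


subsection \<open>The algorithm\<close>

fun fastmix_iter :: "real \<Rightarrow> real^'m^'m \<Rightarrow> real^'d^'m \<Rightarrow> nat \<Rightarrow> real^'d^'m" where
  "fastmix_iter \<eta> W X 0 = X"
| "fastmix_iter \<eta> W X (Suc 0) = X"
| "fastmix_iter \<eta> W X (Suc (Suc k)) =
     (1 + \<eta>) *\<^sub>R (W ** fastmix_iter \<eta> W X (Suc k)) - \<eta> *\<^sub>R fastmix_iter \<eta> W X k"

definition fastmix :: "real^'m^'m \<Rightarrow> nat \<Rightarrow> real^'d^'m \<Rightarrow> real^'d^'m" where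
  "fastmix W K X = fastmix_iter (1 / (1 + sqrt (1 - (lambda2 W)\<^sup>2))) W X K"

definition grad_rows :: "('m \<Rightarrow> real^'d \<Rightarrow> real) \<Rightarrow> real^'d^'m \<Rightarrow> real^'d^'m" where
  "grad_rows f X = (\<chi> i. gradient (f i) (X $ i))"

definition prox_rows :: "real \<Rightarrow> (real^'d \<Rightarrow> real) \<Rightarrow> real^'d^'m \<Rightarrow> real^'d^'m" where
  "prox_rows \<gamma> g X = (\<chi> i. prox \<gamma> g (X $ i))"

text \<open>The sequences are indexed from \<open>1\<close>; their values at \<open>0\<close> are unconstrained.\<close>

definition odapg_run ::
  "('m::finite \<Rightarrow> real^'d \<Rightarrow> real) \<Rightarrow> (real^'d \<Rightarrow> real) \<Rightarrow> real^'m^'m \<Rightarrow> nat \<Rightarrow>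
   (nat \<Rightarrow> real) \<Rightarrow> (nat \<Rightarrow> real) \<Rightarrow> real^'d \<Rightarrow>
   (nat \<Rightarrow> real^'d^'m) \<Rightarrow> (nat \<Rightarrow> real^'d^'m) \<Rightarrow> (nat \<Rightarrow> real^'d^'m) \<Rightarrow> (nat \<Rightarrow> real^'d^'m) \<Rightarrow> bool"
where
  "odapg_run f g W K \<gamma> \<tau> x1 x s z y \<longleftrightarrow>
     x 1 = (\<chi> i. x1) \<and> y 1 = x 1 \<and> z 1 = x 1 \<and> s 1 = grad_rows f (x 1) \<and>
     (\<forall>t\<ge>1.
        x (t + 1) = \<tau> t *\<^sub>R z t + (1 - \<tau> t) *\<^sub>R y t \<and>
        s (t + 1) = fastmix W K (s t + grad_rows f (x (t + 1)) - grad_rows f (x t)) \<and>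
        z (t + 1) = fastmix W K (prox_rows (\<gamma> t) g (z t - \<gamma> t *\<^sub>R s (t + 1))) \<and>
        y (t + 1) = fastmix W K (\<tau> t *\<^sub>R z (t + 1) + (1 - \<tau> t) *\<^sub>R y t))"

text \<open>
  The universal constant hidden in the \<open>O\<close>-notation. It has to be independent of the number of agents
  and of the dimension, which are types here, so an existential quantifier inside the theorem would
  let it depend on them; it is therefore a closed numeral. No attempt is made to optimise it.
\<close>

definition universal_const :: real where
  "universal_const = 10 ^ 6"

end

theory Submission
  imports Defs
begin

text \<open>
  In this overview \<open>z\<close>, \<open>y\<close>, \<open>x\<close> stand for the row means of the iterates. FastMix preserves row means, and
  gradient tracking keeps the mean of \<open>s\<close> equal to the mean of the local gradients. So the row means
  perform an accelerated proximal gradient method for \<open>F\<close> with an inexact gradient, and the inexactness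
  is measured by the \<open>spread\<close> of the iterates, their Frobenius distance to the matrices with equal rows.
  The proof is a single Lyapunov inequality that couples the accelerated method with these spreads.

  \<^bold>\<open>Mixing.\<close> On an eigenvector of \<open>W\<close> with eigenvalue \<open>l\<close>, FastMix multiplies by a number that satisfies a
  two-term recurrence. Along this recurrence a quadratic form decays by exactly the factor \<open>\<eta>\<close> per step, and
  the choice of \<open>\<eta>\<close> makes the form positive definite for all \<open>0 \<le> l \<le> \<lambda>\<^sub>2\<close>. Since \<open>1 / \<eta> \<ge> 1 + sqrt (1 - \<lambda>\<^sub>2)\<close>,
  the \<open>K \<ge> 15 / sqrt (1 - \<lambda>\<^sub>2)\<close> iterations shrink the squared spread by a factor of at least \<open>1000\<close>
  (\<open>spread_fastmix\<close>). The spectral theorem for self-adjoint operators turns the scalar bound into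
  the bound for matrices.

  \<^bold>\<open>Descent.\<close> One step for the row means contracts \<open>m (F y - F x*) + (1 + \<tau>) \<mu> / 2 * m |z - x*|\<^sup>2\<close> by \<open>1 - \<tau> / 2\<close>,
  up to terms that are quadratic in the spreads (\<open>accelerated_descent\<close>). Two negative terms are kept in this
  estimate: one in the movement of \<open>z\<close>, and one in the difference between the gradients at \<open>y\<close> and at the new
  \<open>x\<close>. The second one comes from the cocoercivity of the gradients. It is essential: the change of the
  gradients drives the spread of \<open>s\<close>, and bounding it by the distance of \<open>x\<close> to its successor would cost a
  fixed multiple of the potential, whereas the contraction gains only the fraction \<open>\<tau> / 2\<close> of it.

  \<^bold>\<open>Coupling.\<close> With the spreads of \<open>x\<close> and \<open>y\<close> divided by \<open>\<tau>\<close> and that of \<open>s\<close> multiplied by \<open>\<gamma>\<close>, the parameter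
  choice \<open>L \<gamma> \<tau> = 1 / 400\<close> makes all coefficients numerical. The mixing factor
  then lets a fixed positive combination of the potential and the squared spreads contract by
  \<open>1 - \<tau> / 2\<close> (\<open>lyapunov_arithmetic\<close>, \<open>lyapunov_step\<close>). As \<open>\<tau> = 1 / (20 sqrt (L / \<mu>))\<close>, this is the
  claimed number of iterations, and \<open>K \<le> 16 / sqrt (1 - \<lambda>\<^sub>2)\<close> gives the number of communication rounds.
\<close>


section \<open>Spectral theorem for self-adjoint operators\<close>

text \<open>
  First-order optimality for the Rayleigh quotient. The residual \<open>r = A e - (e \<bullet> A e) e\<close> lies in \<open>S\<close>, and
  moving from \<open>e\<close> in the direction \<open>r\<close> would increase the quotient to first order unless \<open>r = 0\<close>.
\<close>

lemma self_adjoint_max_eigenvector: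
  fixes A :: "'a::euclidean_space \<Rightarrow> 'a"
  assumes lin: "linear A" and sa: "\<And>x y. A x \<bullet> y = x \<bullet> A y"
    and S: "subspace S" and inv: "A ` S \<subseteq> S" and e: "e \<in> S" "norm e = 1"
    and max: "\<And>y. y \<in> S \<Longrightarrow> y \<bullet> A y \<le> (e \<bullet> A e) * (y \<bullet> y)"
  shows "A e = (e \<bullet> A e) *\<^sub>R e"
proof -
  define l where "l = e \<bullet> A e"
  define r where "r = A e - l *\<^sub>R e"
  have rS: "r \<in> S"
    unfolding r_def using inv e S by (auto intro: subspace_diff subspace_mul)
  have ee: "e \<bullet> e = 1"
    using e by (simp add: dot_square_norm)
  define c where "c = r \<bullet> (l *\<^sub>R r - A r)"
  have key: "2 * (r \<bullet> r) \<le> t * c" if "t > 0" for t :: real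
  proof -
    let ?y = "e + t *\<^sub>R r"
    have "?y \<in> S"
      using e rS S by (auto intro: subspace_add subspace_mul)
    then have "0 \<le> l * (?y \<bullet> ?y) - ?y \<bullet> A ?y"
      using max l_def by auto
    also have "\<dots> = t * (t * c - 2 * (r \<bullet> r))"
    proof -
      have Ay: "A ?y = A e + t *\<^sub>R A r"
        using lin by (simp add: linear_add linear_scale)
      have er: "A e = r + l *\<^sub>R e" unfolding r_def by simp
      have "e \<bullet> A r = r \<bullet> r + l * (e \<bullet> r)"
        using sa[of e r] er by (simp add: inner_add_left)
      moreover have "e \<bullet> r = 0"
        unfolding r_def by (simp add: inner_diff_right ee l_def)
      ultimately show ?thesis
        unfolding c_def Ay
        by (simp add: er ee inner_add_left inner_add_right inner_diff_right inner_commute algebra_simps)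
    qed
    finally show ?thesis
      using that by (simp add: zero_le_mult_iff)
  qed
  have "r \<bullet> r \<le> 0"
  proof (rule ccontr)
    assume "\<not> r \<bullet> r \<le> 0"
    then have p: "r \<bullet> r > 0" by linarith
    \<comment> \<open>a step length for which the second-order term \<open>t * c\<close> cannot reach \<open>2 * (r \<bullet> r)\<close>\<close>
    define t where "t = (r \<bullet> r) / (1 + \<bar>c\<bar>)"
    have "t > 0"
      unfolding t_def using p by (intro divide_pos_pos) auto
    moreover have "t + t * \<bar>c\<bar> = r \<bullet> r"
    proof -
      have "1 + \<bar>c\<bar> \<noteq> 0" by linarith
      then have "t * (1 + \<bar>c\<bar>) = r \<bullet> r" by (simp add: t_def)
      then show ?thesis by (simp add: distrib_left)
    qed
    moreover have "t * c \<le> t * \<bar>c\<bar>"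
      using \<open>t > 0\<close> by (intro mult_left_mono) auto
    ultimately show False
      using key[of t] p by linarith
  qed
  then have "r = 0" by (metis inner_gt_zero_iff not_le)
  then show ?thesis unfolding r_def l_def by simp
qed

text \<open>
  By compactness the Rayleigh quotient attains its maximum on the unit sphere of \<open>S\<close>, which yields an
  eigenvector \<open>e\<close>. The orthogonal complement of \<open>e\<close> in \<open>S\<close> is again invariant and has smaller dimension.
\<close>

lemma self_adjoint_spectral_on:
  fixes A :: "'a::euclidean_space \<Rightarrow> 'a"
  assumes lin: "linear A" and sa: "\<And>x y. A x \<bullet> y = x \<bullet> A y"
  shows "subspace S \<Longrightarrow> A ` S \<subseteq> S \<Longrightarrow>
    \<exists>B\<subseteq>S. finite B \<and> pairwise orthogonal B \<and> (\<forall>b\<in>B. norm b = 1 \<and> (\<exists>l. A b = l *\<^sub>R b)) \<and>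
      (\<forall>x\<in>S. x = (\<Sum>b\<in>B. (x \<bullet> b) *\<^sub>R b))"
proof (induction "dim S" arbitrary: S rule: less_induct)
  case less
  show ?case
  proof (cases "S = {0}")
    case True
    then show ?thesis by (intro exI[of _ "{}"]) auto
  next
    case False
    then obtain x0 where x0: "x0 \<in> S" "x0 \<noteq> 0"
      using subspace_0[OF less.prems(1)] by blast
    let ?K = "S \<inter> sphere 0 1"
    have "compact ?K"
      by (intro closed_Int_compact closed_subspace less.prems compact_sphere)
    moreover have "(1 / norm x0) *\<^sub>R x0 \<in> ?K"
      using x0 less.prems(1) by (auto intro: subspace_mul)
    moreover have "continuous_on ?K (\<lambda>x. x \<bullet> A x)"
      using linear_continuous_on[OF linear_conv_bounded_linear[THEN iffD1, OF lin]]
      by (intro continuous_intros) auto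
    ultimately obtain e where e: "e \<in> ?K" and emax: "\<And>y. y \<in> ?K \<Longrightarrow> y \<bullet> A y \<le> e \<bullet> A e"
      using continuous_attains_sup[of ?K "\<lambda>x. x \<bullet> A x"] by blast
    have eS: "e \<in> S" and ne: "norm e = 1" using e by auto
    have ee: "e \<bullet> e = 1" using ne by (simp add: dot_square_norm)
    have "y \<bullet> A y \<le> (e \<bullet> A e) * (y \<bullet> y)" if "y \<in> S" for y
    proof (cases "y = 0")
      case True
      then show ?thesis using lin by (simp add: linear_0)
    next
      case False
      let ?u = "(1 / norm y) *\<^sub>R y"
      have "?u \<in> ?K" using that False less.prems(1) by (auto intro: subspace_mul)
      then have "?u \<bullet> A ?u \<le> e \<bullet> A e" by (rule emax)
      then show ?thesis using lin False
        by (simp add: linear_scale dot_square_norm power2_eq_square field_simps)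
    qed
    then have Ae: "A e = (e \<bullet> A e) *\<^sub>R e"
      using self_adjoint_max_eigenvector[OF lin sa less.prems eS ne] by blast
    let ?S = "{x \<in> S. e \<bullet> x = 0}"
    have sub: "subspace ?S"
      using less.prems(1) by (auto simp: subspace_def inner_add_right)
    have inv: "A ` ?S \<subseteq> ?S"
    proof
      fix u assume "u \<in> A ` ?S"
      then obtain v where v: "v \<in> S" "e \<bullet> v = 0" "u = A v" by auto
      have "e \<bullet> A v = (e \<bullet> A e) * (e \<bullet> v)"
        using sa[of e v] Ae by (metis inner_scaleR_left)
      then show "u \<in> ?S" using v less.prems(2) by auto
    qed
    have "e \<notin> ?S" using ee by simp
    then have "?S \<subset> S" using eS by blast
    then have "dim ?S < dim S"
      using dim_psubset[of ?S S] sub less.prems(1) by (simp add: span_eq_iff[THEN iffD2])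
    then obtain B where B: "B \<subseteq> ?S" "finite B" "pairwise orthogonal B"
      "\<forall>b\<in>B. norm b = 1 \<and> (\<exists>l. A b = l *\<^sub>R b)" "\<forall>x\<in>?S. x = (\<Sum>b\<in>B. (x \<bullet> b) *\<^sub>R b)"
      using less.hyps[OF _ sub inv] by blast
    have eB: "e \<bullet> b = 0" if "b \<in> B" for b using B(1) that by auto
    have "e \<notin> B" using eB ee by auto
    have "x = (\<Sum>b\<in>insert e B. (x \<bullet> b) *\<^sub>R b)" if "x \<in> S" for x
    proof -
      let ?x = "x - (x \<bullet> e) *\<^sub>R e"
      have "?x \<in> ?S"
        using that eS less.prems(1) ee
        by (auto intro: subspace_diff subspace_mul simp: inner_diff_right inner_commute)
      then have "?x = (\<Sum>b\<in>B. (?x \<bullet> b) *\<^sub>R b)" using B(5) by blast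
      also have "\<dots> = (\<Sum>b\<in>B. (x \<bullet> b) *\<^sub>R b)"
        using eB by (intro sum.cong) (auto simp: inner_diff_left)
      finally show ?thesis using B(2) \<open>e \<notin> B\<close> by (simp add: algebra_simps)
    qed
    moreover have "pairwise orthogonal (insert e B)"
      using B(3) eB by (auto simp: pairwise_insert orthogonal_def inner_commute)
    ultimately show ?thesis
      using B eS ne Ae by (intro exI[of _ "insert e B"]) auto
  qed
qed

lemma self_adjoint_spectral:
  fixes A :: "'a::euclidean_space \<Rightarrow> 'a"
  assumes "linear A" and "\<And>x y. A x \<bullet> y = x \<bullet> A y"
  shows "\<exists>B ev. finite B \<and> pairwise orthogonal B \<and> (\<forall>b\<in>B. norm b = 1) \<and>
    (\<forall>b\<in>B. A b = ev b *\<^sub>R b) \<and> (\<forall>x. x = (\<Sum>b\<in>B. (x \<bullet> b) *\<^sub>R b))"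
proof -
  obtain B where B: "finite B" "pairwise orthogonal B"
    "\<forall>b\<in>B. norm b = 1 \<and> (\<exists>l. A b = l *\<^sub>R b)" "\<forall>x\<in>UNIV. x = (\<Sum>b\<in>B. (x \<bullet> b) *\<^sub>R b)"
    using self_adjoint_spectral_on[OF assms subspace_UNIV subset_UNIV] by blast
  then obtain ev where "\<forall>b\<in>B. A b = ev b *\<^sub>R b" by metis
  with B show ?thesis by (intro exI[of _ B] exI[of _ ev]) auto
qed

lemma parseval:
  fixes B :: "'a::real_inner set"
  assumes "finite B" "pairwise orthogonal B" "\<And>b. b \<in> B \<Longrightarrow> norm b = 1"
    and "x = (\<Sum>b\<in>B. c b *\<^sub>R b)"
  shows "(norm x)\<^sup>2 = (\<Sum>b\<in>B. (c b)\<^sup>2)"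
  unfolding assms(4)
  using assms(1-3)
proof (induction B rule: finite_induct)
  case empty
  then show ?case by simp
next
  case (insert e B)
  have "orthogonal (c e *\<^sub>R e) (\<Sum>b\<in>B. c b *\<^sub>R b)"
    using insert.prems(1) insert.hyps(2) 
    by (auto simp: pairwise_insert orthogonal_def inner_sum_right intro!: sum.neutral)
  then have "(norm (c e *\<^sub>R e + (\<Sum>b\<in>B. c b *\<^sub>R b)))\<^sup>2 =
      (norm (c e *\<^sub>R e))\<^sup>2 + (norm (\<Sum>b\<in>B. c b *\<^sub>R b))\<^sup>2"
    by (rule norm_add_Pythagorean)
  with insert show ?case
    by (simp add: pairwise_insert)
qed


section \<open>Spectrum of the weight matrix\<close>

lemma symmetric_matrix_inner:
  fixes A :: "real^'n^'n"
  assumes "transpose A = A"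
  shows "(A *v x) \<bullet> y = x \<bullet> (A *v y)"
  by (metis assms dot_lmul_matrix vector_transpose_matrix)

lemma finite_eigenvalues:
  fixes A :: "real^'n^'n"
  assumes "transpose A = A"
  shows "finite {l. eigenspace A l \<noteq> {0}}"
proof -
  obtain B ev where B: "finite B" "pairwise orthogonal B" "\<forall>b\<in>B. norm b = 1"
    "\<forall>b\<in>B. A *v b = ev b *\<^sub>R b" "\<forall>x. x = (\<Sum>b\<in>B. (x \<bullet> b) *\<^sub>R b)"
    using self_adjoint_spectral[OF matrix_vector_mul_linear symmetric_matrix_inner[OF assms]] by blast
  have "{l. eigenspace A l \<noteq> {0}} \<subseteq> ev ` B"
  proof
    fix l assume "l \<in> {l. eigenspace A l \<noteq> {0}}"
    moreover have "0 \<in> eigenspace A l" by (simp add: eigenspace_def)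
    ultimately obtain v where v: "v \<noteq> 0" "A *v v = l *\<^sub>R v"
      by (auto simp: eigenspace_def)
    have "\<exists>b\<in>B. v \<bullet> b \<noteq> 0"
    proof (rule ccontr)
      assume "\<not> ?thesis"
      then have "(\<Sum>b\<in>B. (v \<bullet> b) *\<^sub>R b) = 0" by (intro sum.neutral) auto
      then show False using B(5)[rule_format, of v] v(1) by metis
    qed
    then obtain b where b: "b \<in> B" "v \<bullet> b \<noteq> 0" by blast
    have "l * (v \<bullet> b) = ev b * (v \<bullet> b)"
      using symmetric_matrix_inner[OF assms, of v b] v B(4) b(1) by simp
    then show "l \<in> ev ` B" using b by auto
  qed
  then show ?thesis using B(1) finite_surj by blast
qed

lemma count_eigenvalue_mset:
  fixes A :: "real^'n^'n"
  assumes "transpose A = A"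
  shows "count (eigenvalue_mset A) l = dim (eigenspace A l)"
proof -
  let ?E = "{l. eigenspace A l \<noteq> {0}}"
  have "count (eigenvalue_mset A) l = (\<Sum>k\<in>?E. if l = k then dim (eigenspace A k) else 0)"
    unfolding eigenvalue_mset_def by (simp add: count_sum eq_commute)
  also have "\<dots> = (if l \<in> ?E then dim (eigenspace A l) else 0)"
    using finite_eigenvalues[OF assms] by (simp add: sum.delta')
  also have "\<dots> = dim (eigenspace A l)" by auto
  finally show ?thesis .
qed

lemma mem_eigenvalue_mset:
  fixes A :: "real^'n^'n"
  assumes "transpose A = A"
  shows "l \<in># eigenvalue_mset A \<longleftrightarrow> (\<exists>v. v \<noteq> 0 \<and> A *v v = l *\<^sub>R v)"
proof -
  have "l \<in># eigenvalue_mset A \<longleftrightarrow> \<not> eigenspace A l \<subseteq> {0}"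
    by (simp add: count_eigenvalue_mset[OF assms] flip: count_greater_zero_iff dim_eq_0)
  then show ?thesis by (auto simp: eigenspace_def)
qed

lemma weight_matrix_fixed:
  assumes "weight_matrix adj W" and "W *v v = v"
  shows "\<exists>c. v = (\<chi> i. c)"
proof -
  have "(mat 1 - W) *v v = 0"
    using assms(2) by (simp add: matrix_vector_mult_diff_rdistrib)
  then have "v \<in> span {\<chi> i. 1}" using assms(1) by (auto simp: weight_matrix_def)
  then obtain c where "v = c *\<^sub>R (\<chi> i. 1)" by (auto simp: span_singleton)
  then show ?thesis by (intro exI[of _ c]) (simp add: vec_eq_iff)
qed

lemma weight_matrix_eigenvalue_bounds:
  assumes "weight_matrix adj W" and "v \<noteq> 0" and "W *v v = l *\<^sub>R v"
  shows "0 \<le> l" "l \<le> 1"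
proof -
  have p: "v \<bullet> v > 0" using assms(2) by simp
  have "0 \<le> v \<bullet> (W *v v)" "0 \<le> v \<bullet> ((mat 1 - W) *v v)"
    using assms(1) by (auto simp: weight_matrix_def loewner_le_def)
  then have "0 \<le> l * (v \<bullet> v)" "0 \<le> (1 - l) * (v \<bullet> v)"
    using assms(3) by (auto simp: matrix_vector_mult_diff_rdistrib inner_diff_right algebra_simps)
  then show "0 \<le> l" "l \<le> 1" using p by (auto simp: zero_le_mult_iff)
qed

text \<open>
  Otherwise \<open>W\<close> would be the identity, whose fixed vectors are not all multiples of the all-ones vector
  once there are two agents.
\<close>

lemma weight_matrix_nontrivial_eigenvalue:
  fixes W :: "real^'m^'m"
  assumes "weight_matrix adj W" and "CARD('m) \<ge> 2"
  shows "\<exists>l v. l \<noteq> 1 \<and> v \<noteq> 0 \<and> W *v v = l *\<^sub>R v"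
proof (rule ccontr)
  assume neg: "\<not> ?thesis"
  have tr: "transpose W = W" using assms(1) by (simp add: weight_matrix_def)
  obtain B ev where B: "finite B" "pairwise orthogonal B" "\<forall>b\<in>B. norm b = 1"
    "\<forall>b\<in>B. W *v b = ev b *\<^sub>R b" "\<forall>x. x = (\<Sum>b\<in>B. (x \<bullet> b) *\<^sub>R b)"
    using self_adjoint_spectral[OF matrix_vector_mul_linear symmetric_matrix_inner[OF tr]] by blast
  have Wb: "W *v b = b" if "b \<in> B" for b
  proof -
    have "b \<noteq> 0" using B(3) that by auto
    then have "ev b = 1" using B(4) that neg by blast
    then show ?thesis using B(4) that by simp
  qed
  have "W *v x = x" for x
  proof -
    have "W *v x = W *v (\<Sum>b\<in>B. (x \<bullet> b) *\<^sub>R b)" using B(5)[rule_format, of x] by simp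
    also have "\<dots> = (\<Sum>b\<in>B. (x \<bullet> b) *\<^sub>R b)"
      using Wb by (subst linear_sum[OF matrix_vector_mul_linear])
        (auto simp: matrix_vector_mult_scaleR intro!: sum.cong)
    finally show ?thesis using B(5)[rule_format, of x] by simp
  qed
  then have const: "\<exists>c. v = (\<chi> i. c)" for v :: "real^'m"
    using weight_matrix_fixed[OF assms(1)] by blast
  obtain i j :: 'm where "i \<noteq> j"
    using assms(2) card_le_Suc0_iff_eq[of "UNIV :: 'm set"] by auto
  obtain c where c: "(axis i 1 :: real^'m) = (\<chi> i. c)" using const by blast
  have "c = 1" using arg_cong[OF c, of "\<lambda>v. v $ i"] by (simp add: axis_def)
  moreover have "c = 0" using arg_cong[OF c, of "\<lambda>v. v $ j"] \<open>i \<noteq> j\<close> by (simp add: axis_def)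
  ultimately show False by simp
qed

lemma sorted_le_last: "sorted xs \<Longrightarrow> k \<in> set xs \<Longrightarrow> k \<le> last xs"
  by (induction xs) auto

text \<open>
  The eigenvalue \<open>1\<close> is the largest one and is simple, so it fills exactly the last place of the sorted list
  of eigenvalues. The entry before it, which is \<open>\<lambda>\<^sub>2\<close>, is therefore the largest eigenvalue other than \<open>1\<close>.
\<close>

lemma lambda2_weight_matrix:
  fixes W :: "real^'m^'m"
  assumes wm: "weight_matrix adj W" and card: "CARD('m) \<ge> 2"
  shows "0 \<le> lambda2 W" "lambda2 W < 1"
    and "\<And>v l. v \<noteq> 0 \<Longrightarrow> W *v v = l *\<^sub>R v \<Longrightarrow> l \<noteq> 1 \<Longrightarrow> l \<le> lambda2 W"
proof -
  have tr: "transpose W = W" and one: "W *v (\<chi> i. 1) = (\<chi> i. 1)"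
    using wm by (auto simp: weight_matrix_def)
  define xs where "xs = sorted_list_of_multiset (eigenvalue_mset W)"
  have xs: "sorted xs" "mset xs = eigenvalue_mset W"
    unfolding xs_def by auto
  have mem: "l \<in> set xs \<longleftrightarrow> (\<exists>v. v \<noteq> 0 \<and> W *v v = l *\<^sub>R v)" for l
    using mem_eigenvalue_mset[OF tr] xs(2) by (metis set_mset_mset)
  have "(\<chi> i. 1) \<noteq> (0::real^'m)" by (simp add: vec_eq_iff)
  then have one_mem: "1 \<in> set xs" using mem one by fastforce
  have le1: "l \<le> 1" "0 \<le> l" if "l \<in> set xs" for l
    using that mem[of l] weight_matrix_eigenvalue_bounds[OF wm] by blast+
  define ys where "ys = butlast xs"
  have "xs \<noteq> []" using one_mem by auto
  then have split: "xs = ys @ [last xs]" by (simp add: ys_def)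
  have sys: "sorted ys" and ys_le: "\<And>l. l \<in> set ys \<Longrightarrow> l \<le> last xs"
    using xs(1) by (subst (asm) split, simp add: sorted_append)+
  have set_xs: "set xs = insert (last xs) (set ys)"
    by (subst split) simp
  have "1 \<le> last xs" using one_mem ys_le unfolding set_xs by auto
  then have last1: "last xs = 1" using le1 \<open>xs \<noteq> []\<close> by (simp add: order_antisym)
  have "eigenspace W 1 = {v. (mat 1 - W) *v v = 0}"
    by (auto simp: eigenspace_def matrix_vector_mult_diff_rdistrib)
  also have "\<dots> = span {\<chi> i. 1}"
    using wm by (simp add: weight_matrix_def)
  finally have "eigenspace W 1 = span {\<chi> i. 1}" .
  then have "count (mset xs) 1 \<le> 1"
    using count_eigenvalue_mset[OF tr, of 1] xs(2) dim_le_card'[of "{\<chi> i. 1} :: (real^'m) set"] by simp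
  then have ys1: "1 \<notin> set ys"
    using arg_cong[OF split, of "\<lambda>zs. count (mset zs) 1"] last1 by simp
  have other: "l \<in> set ys" if "v \<noteq> 0" "W *v v = l *\<^sub>R v" "l \<noteq> 1" for v l
    using that mem[of l] set_xs last1 by auto
  then have ysne: "ys \<noteq> []"
    using weight_matrix_nontrivial_eigenvalue[OF wm card] by fastforce
  have "lambda2 W = rev xs ! 1" by (simp add: lambda2_def xs_def)
  also have "\<dots> = last ys"
    using ysne by (subst split) (simp add: rev_nth last_conv_nth)
  finally have l2: "lambda2 W = last ys" .
  have last_mem: "last ys \<in> set ys" using ysne by simp
  then have "last ys \<in> set xs" using set_xs by simp
  then show "0 \<le> lambda2 W" "lambda2 W < 1"
    using le1[of "last ys"] ys1 last_mem l2 by (auto simp: less_le)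
  show "l \<le> lambda2 W" if "v \<noteq> 0" "W *v v = l *\<^sub>R v" "l \<noteq> 1" for v l
  proof -
    have "l \<in> set ys" using other that by blast
    then show ?thesis using sys l2 sorted_le_last by simp
  qed
qed


section \<open>Scalar analysis of FastMix\<close>

text \<open>
  The factor by which FastMix, after \<open>k\<close> iterations, multiplies an eigenvector with eigenvalue \<open>l\<close>.
\<close>

fun mix_factor :: "real \<Rightarrow> real \<Rightarrow> nat \<Rightarrow> real" where
  "mix_factor \<eta> l 0 = 1"
| "mix_factor \<eta> l (Suc 0) = 1"
| "mix_factor \<eta> l (Suc (Suc k)) = (1 + \<eta>) * l * mix_factor \<eta> l (Suc k) - \<eta> * mix_factor \<eta> l k"

text \<open>
  The product of the roots of the characteristic polynomial \<open>X\<^sup>2 - (1 + \<eta>) l X + \<eta>\<close> is \<open>\<eta>\<close>. Hence the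
  polynomial, read as a quadratic form in two successive factors, is scaled by exactly \<open>\<eta>\<close> in each step.
\<close>

lemma mix_factor_energy:
  "(mix_factor \<eta> l (Suc k))\<^sup>2 - (1 + \<eta>) * l * mix_factor \<eta> l (Suc k) * mix_factor \<eta> l k
     + \<eta> * (mix_factor \<eta> l k)\<^sup>2 = \<eta> ^ k * ((1 + \<eta>) * (1 - l))"
proof (induction k)
  case 0
  then show ?case by (simp add: algebra_simps)
next
  case (Suc k)
  let ?u = "mix_factor \<eta> l k" and ?v = "mix_factor \<eta> l (Suc k)"
  have "((1 + \<eta>) * l * ?v - \<eta> * ?u)\<^sup>2 - (1 + \<eta>) * l * ((1 + \<eta>) * l * ?v - \<eta> * ?u) * ?v + \<eta> * ?v\<^sup>2
      = \<eta> * (?v\<^sup>2 - (1 + \<eta>) * l * ?v * ?u + \<eta> * ?u\<^sup>2)"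
    by (simp add: power2_eq_square algebra_simps)
  with Suc show ?case by simp
qed

text \<open>
  Both inequalities concern \<open>(1 + c)\<^sup>2 (4 \<eta> - ((1 + \<eta>) l)\<^sup>2)\<close> for \<open>\<eta> = 1 / (1 + c)\<close>. Its positivity says that
  the energy form is definite. The second inequality compares it with the initial energy, which is
  proportional to \<open>1 - l\<close>; both quantities vanish as \<open>l\<close> and \<open>\<lambda>\<^sub>2\<close> tend to \<open>1\<close>, and only their ratio
  stays bounded.
\<close>

lemma mix_factor_discriminant:
  fixes l l2 :: real
  assumes "0 \<le> l" "l \<le> l2" "l2 < 1"
  defines "c \<equiv> sqrt (1 - l2\<^sup>2)"
  shows "0 < 4 * (1 + c) - ((2 + c) * l)\<^sup>2"
    and "2 * (2 + c) * (1 - l) \<le> 4 * (1 + c) - ((2 + c) * l)\<^sup>2"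
proof -
  have l2: "l2\<^sup>2 < 1" using assms by (simp add: power_less_one_iff abs_square_less_1)
  have c: "0 < c" "c\<^sup>2 = 1 - l2\<^sup>2" using l2 by (auto simp: c_def)
  have c1: "c \<le> 1" by (simp add: c_def)
  have ll: "l\<^sup>2 \<le> 1 - c\<^sup>2" using assms c by (simp add: power_mono)
  have "((2 + c) * l)\<^sup>2 = (2 + c)\<^sup>2 * l\<^sup>2" by (simp add: power_mult_distrib)
  also have "\<dots> \<le> (2 + c)\<^sup>2 * (1 - c\<^sup>2)" by (intro mult_left_mono ll) auto
  also have "\<dots> = 4 * (1 + c) - c\<^sup>2 * (1 + c) * (3 + c)"
    by (simp add: power2_eq_square algebra_simps)
  finally have le: "((2 + c) * l)\<^sup>2 \<le> 4 * (1 + c) - c\<^sup>2 * (1 + c) * (3 + c)" .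
  show "0 < 4 * (1 + c) - ((2 + c) * l)\<^sup>2"
  proof -
    have "0 < c\<^sup>2 * (1 + c) * (3 + c)" using c(1) by (intro mult_pos_pos) auto
    with le show ?thesis by linarith
  qed
  have sq: "l\<^sup>2 \<le> (1 - c\<^sup>2 / 2)\<^sup>2"
  proof -
    have "(1 - c\<^sup>2 / 2)\<^sup>2 = (1 - c\<^sup>2) + (c\<^sup>2 / 2)\<^sup>2" by (simp add: power2_eq_square algebra_simps)
    then show ?thesis using ll zero_le_power2[of "c\<^sup>2 / 2"] by linarith
  qed
  have "c\<^sup>2 \<le> 1" using c(1) c1 by (simp add: power_le_one)
  then have "0 \<le> 1 - c\<^sup>2 / 2" by linarith
  with sq have "l \<le> 1 - c\<^sup>2 / 2" by (rule power2_le_imp_le)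
  then have "(2 + c) * l \<le> (2 + c) * (1 - c\<^sup>2 / 2)" using c(1) by (intro mult_left_mono) auto
  also have "\<dots> = 2 + (c - c\<^sup>2) - c * c\<^sup>2 / 2" by (simp add: power2_eq_square algebra_simps)
  also have "\<dots> \<le> 2 + (c - c\<^sup>2)" using c(1) by simp
  finally have p: "(2 + c) * l \<le> 2 + (c - c\<^sup>2)" .
  define q where "q = (2 + c) * l"
  have q0: "0 \<le> q" using c(1) assms by (simp add: q_def)
  have d0: "0 \<le> c - c\<^sup>2" using c(1) c1 by (simp add: power2_eq_square mult_left_le)
  \<comment> \<open>expanding the claim in \<open>q\<close> leaves this inequality\<close>
  have "q * (q - 2) \<le> 2 * c"
  proof (cases "q \<le> 2")
    case True
    then have "q * (q - 2) \<le> 0" using q0 by (simp add: mult_nonneg_nonpos)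
    then show ?thesis using c(1) by linarith
  next
    case False
    then have "q * (q - 2) \<le> (2 + (c - c\<^sup>2)) * (c - c\<^sup>2)"
      using p q0 d0 by (intro mult_mono) (auto simp: q_def)
    also have "\<dots> = 2 * c - c\<^sup>2 * (1 + c * (2 - c))"
      by (simp add: power2_eq_square algebra_simps)
    also have "\<dots> \<le> 2 * c" using c(1) c1 by simp
    finally show ?thesis .
  qed
  then show "2 * (2 + c) * (1 - l) \<le> 4 * (1 + c) - ((2 + c) * l)\<^sup>2"
    unfolding q_def[symmetric] using q_def by (simp add: power2_eq_square algebra_simps)
qed

text \<open>
  Completing the square in the energy form leaves \<open>(4 \<eta> - ((1 + \<eta>) l)\<^sup>2) v\<^sup>2 \<le> 4 \<eta> E\<close> for the current factor
  \<open>v\<close> and the energy \<open>E\<close>, and the energy is known exactly.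
\<close>

lemma mix_factor_bound:
  fixes l l2 :: real
  assumes l: "0 \<le> l" "l \<le> l2" "l2 < 1"
  defines "\<eta> \<equiv> 1 / (1 + sqrt (1 - l2\<^sup>2))"
  shows "(mix_factor \<eta> l (Suc k))\<^sup>2 \<le> 2 * \<eta> ^ k"
proof -
  define c where "c = sqrt (1 - l2\<^sup>2)"
  note D = mix_factor_discriminant[OF l, folded c_def]
  have c: "0 \<le> c" unfolding c_def using l by (simp add: power_le_one)
  have \<eta>: "\<eta> = 1 / (1 + c)" by (simp add: \<eta>_def c_def)
  have \<eta>0: "0 < \<eta>" using c by (simp add: \<eta>)
  define a where "a = (1 + \<eta>) * l"
  let ?u = "mix_factor \<eta> l k" and ?v = "mix_factor \<eta> l (Suc k)"
  define E where "E = \<eta> ^ k * ((1 + \<eta>) * (1 - l))"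
  have E: "?v\<^sup>2 - a * ?v * ?u + \<eta> * ?u\<^sup>2 = E"
    using mix_factor_energy[of \<eta> l k] by (simp add: a_def E_def)
  have "4 * \<eta> * E = (4 * \<eta> - a\<^sup>2) * ?v\<^sup>2 + (2 * \<eta> * ?u - a * ?v)\<^sup>2"
    unfolding E[symmetric] by (simp add: power2_eq_square algebra_simps)
  then have le: "(4 * \<eta> - a\<^sup>2) * ?v\<^sup>2 \<le> 4 * \<eta> * E" by simp
  have ac: "(1 + c) * a = (2 + c) * l"
    using c by (simp add: a_def \<eta> field_simps)
  have \<eta>c: "(1 + c) * \<eta> = 1" using c by (simp add: \<eta>)
  have ex: "(1 + c)\<^sup>2 * (4 * \<eta> - a\<^sup>2) = 4 * (1 + c) - ((2 + c) * l)\<^sup>2"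
  proof -
    have "(1 + c)\<^sup>2 * (4 * \<eta> - a\<^sup>2) = 4 * (1 + c) * ((1 + c) * \<eta>) - ((1 + c) * a)\<^sup>2"
      by (simp add: power2_eq_square algebra_simps)
    then show ?thesis by (simp add: ac \<eta>c)
  qed
  have pos: "0 < 4 * \<eta> - a\<^sup>2"
  proof -
    have "0 < (1 + c)\<^sup>2 * (4 * \<eta> - a\<^sup>2)" using D(1) ex by simp
    then show ?thesis by (simp add: zero_less_mult_iff)
  qed
  have "(1 + c)\<^sup>2 * (4 * \<eta> * ((1 + \<eta>) * (1 - l))) = 4 * ((1 + c) * \<eta>) * ((1 + c) + (1 + c) * \<eta>) * (1 - l)"
    by (simp add: power2_eq_square algebra_simps)
  also have "\<dots> = 2 * (2 * (2 + c) * (1 - l))" unfolding \<eta>c by (simp add: algebra_simps)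
  also have "\<dots> \<le> 2 * ((1 + c)\<^sup>2 * (4 * \<eta> - a\<^sup>2))" using D(2) unfolding ex by simp
  also have "\<dots> = (1 + c)\<^sup>2 * (2 * (4 * \<eta> - a\<^sup>2))" by simp
  finally have "4 * \<eta> * ((1 + \<eta>) * (1 - l)) \<le> 2 * (4 * \<eta> - a\<^sup>2)"
    using c by (subst (asm) mult_le_cancel_left_pos) auto
  then have *: "\<eta> ^ k * (4 * \<eta> * ((1 + \<eta>) * (1 - l))) \<le> \<eta> ^ k * (2 * (4 * \<eta> - a\<^sup>2))"
    using \<eta>0 by (intro mult_left_mono) auto
  have "(4 * \<eta> - a\<^sup>2) * ?v\<^sup>2 \<le> (4 * \<eta> - a\<^sup>2) * (2 * \<eta> ^ k)"
  proof -
    have "4 * \<eta> * E = \<eta> ^ k * (4 * \<eta> * ((1 + \<eta>) * (1 - l)))"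
      by (simp add: E_def)
    moreover have "\<eta> ^ k * (2 * (4 * \<eta> - a\<^sup>2)) = (4 * \<eta> - a\<^sup>2) * (2 * \<eta> ^ k)"
      by simp
    ultimately show ?thesis using le * by linarith
  qed
  then show ?thesis using pos by simp
qed

text \<open>
  Put \<open>s = sqrt (1 - \<lambda>\<^sub>2)\<close>. Convexity of \<open>exp\<close> gives \<open>1 + s \<ge> 2 powr s\<close>, and the \<open>k \<ge> 15 / s - 1 \<ge> 14 / s\<close>
  mixing steps gain the factor \<open>2 ^ 14\<close>.
\<close>

lemma mix_rate_power:
  fixes l2 :: real
  assumes l2: "0 \<le> l2" "l2 < 1" and K: "15 / sqrt (1 - l2) \<le> real (Suc k)"
  shows "2 * (1 / (1 + sqrt (1 - l2\<^sup>2))) ^ k \<le> 1 / 1000"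
proof -
  define s where "s = sqrt (1 - l2)"
  have s: "0 < s" "s \<le> 1" using l2 by (auto simp: s_def)
  have "(1 - l2) * 1 \<le> (1 - l2) * (1 + l2)" using l2 by (intro mult_left_mono) auto
  then have "s \<le> sqrt (1 - l2\<^sup>2)"
    unfolding s_def by (simp add: power2_eq_square algebra_simps)
  then have "1 / (1 + sqrt (1 - l2\<^sup>2)) \<le> 1 / (1 + s)"
    using s by (intro divide_left_mono) auto
  then have "(1 / (1 + sqrt (1 - l2\<^sup>2))) ^ k \<le> (1 / (1 + s)) ^ k"
    using l2 by (intro power_mono) (auto simp: power_le_one)
  also have "\<dots> = 1 / (1 + s) ^ k" by (simp add: power_one_over)
  also have "\<dots> \<le> 1 / 2 ^ 14"
  proof -
    have "exp ((1 - s) *\<^sub>R 0 + s *\<^sub>R ln 2) \<le> (1 - s) * exp 0 + s * exp (ln (2::real))"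
      using s by (intro convex_onD[OF exp_convex]) auto
    then have "exp (s * ln 2) \<le> 1 + s" by simp
    then have e: "exp (s * ln 2) ^ k \<le> (1 + s) ^ k" by (intro power_mono) auto
    have "15 / s - 1 \<le> real k" using K by (simp add: s_def)
    then have "15 - s \<le> s * real k" using s by (simp add: field_simps)
    then have "14 * ln 2 \<le> (s * real k) * ln (2::real)"
      using s by (intro mult_right_mono) auto
    then have "exp (14 * ln 2) \<le> exp (real k * (s * ln (2::real)))" by (simp add: mult_ac)
    moreover have "exp (14 * ln (2::real)) = 2 ^ 14"
      using exp_of_nat_mult[of 14 "ln (2::real)"] by simp
    moreover have "exp (real k * (s * ln 2)) = exp (s * ln 2) ^ k"
      by (rule exp_of_nat_mult)
    ultimately have "2 ^ 14 \<le> (1 + s) ^ k" using e by simp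
    then show ?thesis using s by (intro divide_left_mono) auto
  qed
  finally show ?thesis by simp
qed


section \<open>Contraction of the spread by FastMix\<close>

definition consensus :: "real^'d \<Rightarrow> real^'d^'m" where
  "consensus u = (\<chi> i. u)"

definition row_mean :: "real^'d^'m \<Rightarrow> real^'d" where
  "row_mean X = (1 / real CARD('m)) *\<^sub>R (\<Sum>i\<in>UNIV. X $ i)"

definition spread :: "real^'d^'m \<Rightarrow> real" where
  "spread X = norm (X - consensus (row_mean X))"

lemma consensus_nth [simp]: "consensus u $ i = u"
  by (simp add: consensus_def)

lemma consensus_diff: "consensus (u - v) = consensus u - consensus v"
  and consensus_add: "consensus (u + v) = consensus u + consensus v"
  and consensus_scaleR: "consensus (c *\<^sub>R u) = c *\<^sub>R consensus u"
  by (simp_all add: vec_eq_iff)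

lemma row_mean_add: "row_mean (X + Y) = row_mean X + row_mean Y"
  and row_mean_diff: "row_mean (X - Y) = row_mean X - row_mean Y"
  and row_mean_scaleR: "row_mean (c *\<^sub>R X) = c *\<^sub>R row_mean X"
  by (simp_all add: row_mean_def sum.distrib sum_subtractf scaleR_add_right scaleR_diff_right
      scaleR_sum_right)

lemma sum_rows: "(\<Sum>i\<in>UNIV. X $ i) = real CARD('m) *\<^sub>R row_mean (X :: real^'d^'m)"
  by (simp add: row_mean_def)

lemma row_mean_consensus [simp]: "row_mean (consensus u :: real^'d^'m) = u"
proof -
  have "(\<Sum>i\<in>(UNIV::'m set). u) = real CARD('m) *\<^sub>R u"
    by (simp only: sum_constant_scaleR)
  then show ?thesis by (simp add: row_mean_def)
qed

lemma norm_matrix_power2: "(norm (X :: real^'d^'m))\<^sup>2 = (\<Sum>i\<in>UNIV. (norm (X $ i))\<^sup>2)"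
  by (simp add: norm_vec_def L2_set_def sum_nonneg)

lemma inner_consensus: "X \<bullet> consensus u = real CARD('m) * (row_mean (X :: real^'d^'m) \<bullet> u)"
proof -
  have "X \<bullet> consensus u = (\<Sum>i\<in>UNIV. X $ i) \<bullet> u"
    by (simp add: inner_vec_def[of X] inner_sum_left)
  then show ?thesis by (simp add: sum_rows)
qed

lemma norm_consensus: "(norm (consensus u :: real^'d^'m))\<^sup>2 = real CARD('m) * (norm u)\<^sup>2"
  by (simp add: norm_matrix_power2)

text \<open>
  Pythagoras for the splitting of \<open>X - consensus u\<close> into its centred part and its constant part.
\<close>

lemma bias_variance:
  "(norm (X - consensus u))\<^sup>2 = (spread X)\<^sup>2 + real CARD('m) * (norm (row_mean (X :: real^'d^'m) - u))\<^sup>2"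
proof -
  let ?D = "X - consensus (row_mean X)" and ?c = "consensus (row_mean X - u) :: real^'d^'m"
  have "?D \<bullet> ?c = 0"
    by (simp add: inner_consensus row_mean_diff)
  then have "(norm (?D + ?c))\<^sup>2 = (norm ?D)\<^sup>2 + (norm ?c)\<^sup>2"
    by (simp add: norm_add_Pythagorean orthogonal_def)
  then show ?thesis
    by (simp add: consensus_diff norm_consensus[symmetric] spread_def)
qed

lemma spread_nonneg [simp]: "0 \<le> spread X"
  by (simp add: spread_def)

lemma spread_le_norm: "spread X \<le> norm (X - consensus u)"
  by (rule power2_le_imp_le) (simp_all add: bias_variance)

lemma spread_add: "spread (X + Y) \<le> spread X + spread Y"
proof -
  have eq: "X + Y - consensus (row_mean (X + Y)) = (X - consensus (row_mean X)) + (Y - consensus (row_mean Y))"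
    by (simp add: row_mean_add consensus_add)
  show ?thesis unfolding spread_def eq by (rule norm_triangle_ineq)
qed

lemma spread_scaleR: "spread (c *\<^sub>R X) = \<bar>c\<bar> * spread X"
proof -
  have "c *\<^sub>R X - consensus (row_mean (c *\<^sub>R X)) = c *\<^sub>R (X - consensus (row_mean X))"
    by (simp add: row_mean_scaleR consensus_scaleR scaleR_diff_right)
  then show ?thesis unfolding spread_def by simp
qed

lemma matrix_mult_row: "(W ** X) $ i = (\<Sum>k\<in>UNIV. W $ i $ k *\<^sub>R (X :: real^'d^'m) $ k)"
  by (simp add: vec_eq_iff matrix_matrix_mult_def)

lemma linear_matrix_mult: "linear (\<lambda>X :: real^'d^'m. (W :: real^'m^'n) ** X)"
proof (rule linearI)
  show "W ** (X + Y) = W ** X + W ** Y" for X Y :: "real^'d^'m"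
    by (rule matrix_add_ldistrib)
  show "W ** (c *\<^sub>R X) = c *\<^sub>R (W ** X)" for c and X :: "real^'d^'m"
    by (simp add: matrix_scalar_ac scalar_matrix_assoc)
qed

lemma symmetric_matrix_mult_inner:
  fixes X Y :: "real^'d^'m"
  assumes "transpose W = W"
  shows "(W ** X) \<bullet> Y = X \<bullet> (W ** Y)"
proof -
  have sym: "W $ i $ k = W $ k $ i" for i k
    using arg_cong[OF assms, of "\<lambda>M. M $ k $ i"] by (simp add: transpose_def)
  have "(W ** X) \<bullet> Y = (\<Sum>i\<in>UNIV. \<Sum>k\<in>UNIV. W $ i $ k * (X $ k \<bullet> Y $ i))"
    by (simp add: inner_vec_def[of "W ** X"] matrix_mult_row inner_sum_left)
  also have "\<dots> = (\<Sum>k\<in>UNIV. \<Sum>i\<in>UNIV. W $ i $ k * (X $ k \<bullet> Y $ i))"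
    by (rule sum.swap)
  also have "\<dots> = X \<bullet> (W ** Y)"
    by (simp add: inner_vec_def[of X] matrix_mult_row inner_sum_right sym)
  finally show ?thesis .
qed

lemma fastmix_iter_spectral:
  fixes W :: "real^'m^'m" and B :: "(real^'d^'m) set"
  assumes B: "\<forall>b\<in>B. W ** b = ev b *\<^sub>R b"
  shows "fastmix_iter \<eta> W (\<Sum>b\<in>B. c b *\<^sub>R b) k = (\<Sum>b\<in>B. (mix_factor \<eta> (ev b) k * c b) *\<^sub>R b)"
proof (induction k rule: induct_nat_012)
  case (ge2 k)
  have "W ** (\<Sum>b\<in>B. (mix_factor \<eta> (ev b) (Suc k) * c b) *\<^sub>R b)
      = (\<Sum>b\<in>B. W ** ((mix_factor \<eta> (ev b) (Suc k) * c b) *\<^sub>R b))"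
    by (rule linear_sum[OF linear_matrix_mult])
  also have "\<dots> = (\<Sum>b\<in>B. (ev b * mix_factor \<eta> (ev b) (Suc k) * c b) *\<^sub>R b)"
    using B by (intro sum.cong) (simp_all add: linear_scale[OF linear_matrix_mult] mult_ac)
  finally show ?case
    using ge2 by (simp add: scaleR_sum_right flip: sum_subtractf scaleR_diff_left)
      (simp add: algebra_simps)
qed simp_all

lemma column_matrix_mult: "column j (W ** b) = W *v column j b"
  by (simp add: vec_eq_iff column_def matrix_vector_mult_def matrix_matrix_mult_def)

text \<open>
  The eigenvalue \<open>1\<close> gives no decay, but it has no weight either: the columns of such an eigenmatrix are
  multiples of the all-ones vector, and these are orthogonal to the columns of centred matrices.
\<close>

lemma inner_fixed_matrix_eq_0:
  fixes b Y :: "real^'d^'m"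
  assumes wm: "weight_matrix adj W" and b: "W ** b = b" and Y: "row_mean Y = 0"
  shows "Y \<bullet> b = 0"
proof -
  have "\<exists>c. column j b = (\<chi> i. c)" for j
  proof (rule weight_matrix_fixed[OF wm])
    show "W *v column j b = column j b" using column_matrix_mult[of j W b] b by simp
  qed
  then obtain r where r: "\<And>j. column j b = (\<chi> i. r j)" by metis
  have "b $ i $ j = r j" for i j
    using arg_cong[OF r, of "\<lambda>v. v $ i" j] by (simp add: column_def)
  then have "b = consensus (\<chi> j. r j)" by (simp add: vec_eq_iff)
  then show ?thesis using Y by (simp add: inner_consensus)
qed

text \<open>
  The spectral theorem is applied to the operator \<open>X \<mapsto> W ** X\<close> on \<open>m \<times> d\<close> matrices themselves, so that all
  columns are treated at once. Its eigenvalues are eigenvalues of \<open>W\<close> because a nonzero eigenmatrix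
  has a nonzero column.
\<close>

lemma fastmix_contraction:
  fixes W :: "real^'m^'m" and Y :: "real^'d^'m"
  assumes wm: "weight_matrix adj W" and card: "CARD('m) \<ge> 2"
    and K: "15 / sqrt (1 - lambda2 W) \<le> real K" and Y: "row_mean Y = 0"
  shows "(norm (fastmix W K Y))\<^sup>2 \<le> (norm Y)\<^sup>2 / 1000"
proof -
  note l2 = lambda2_weight_matrix[OF wm card]
  define \<eta> where "\<eta> = 1 / (1 + sqrt (1 - (lambda2 W)\<^sup>2))"
  have "0 < 15 / sqrt (1 - lambda2 W)" using l2(2) by simp
  \<comment> \<open>the first two iterates coincide, so that \<open>K\<close> iterations contain only \<open>K - 1\<close> mixing steps\<close>
  with K obtain k where k: "K = Suc k" by (cases K) auto
  have rate: "2 * \<eta> ^ k \<le> 1 / 1000"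
    using mix_rate_power[of "lambda2 W" k] l2 K unfolding \<eta>_def k by blast
  have tr: "transpose W = W" using wm by (simp add: weight_matrix_def)
  obtain B :: "(real^'d^'m) set" and ev where B: "finite B" "pairwise orthogonal B" "\<forall>b\<in>B. norm b = 1"
    "\<forall>b\<in>B. W ** b = ev b *\<^sub>R b" "\<forall>x. x = (\<Sum>b\<in>B. (x \<bullet> b) *\<^sub>R b)"
    using self_adjoint_spectral[OF linear_matrix_mult symmetric_matrix_mult_inner[OF tr]] by blast
  define c where "c b = Y \<bullet> b" for b
  have Yc: "Y = (\<Sum>b\<in>B. c b *\<^sub>R b)" unfolding c_def by (rule B(5)[rule_format])
  have normY: "(norm Y)\<^sup>2 = (\<Sum>b\<in>B. (c b)\<^sup>2)"
    by (rule parseval[OF B(1,2) _ Yc]) (use B(3) in blast)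
  have "fastmix W K Y = (\<Sum>b\<in>B. (mix_factor \<eta> (ev b) K * c b) *\<^sub>R b)"
    unfolding fastmix_def \<eta>_def[symmetric] by (subst Yc) (rule fastmix_iter_spectral[OF B(4)])
  then have "(norm (fastmix W K Y))\<^sup>2 = (\<Sum>b\<in>B. (mix_factor \<eta> (ev b) K * c b)\<^sup>2)"
    by (rule parseval[OF B(1,2), rotated]) (use B(3) in blast)
  also have "\<dots> \<le> (\<Sum>b\<in>B. 1 / 1000 * (c b)\<^sup>2)"
  proof (rule sum_mono)
    fix b assume b: "b \<in> B"
    show "(mix_factor \<eta> (ev b) K * c b)\<^sup>2 \<le> 1 / 1000 * (c b)\<^sup>2"
    proof (cases "ev b = 1")
      case True
      then have "c b = 0"
        unfolding c_def using inner_fixed_matrix_eq_0[OF wm _ Y] B(4) b by simp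
      then show ?thesis by simp
    next
      case False
      have "b \<noteq> 0" using B(3) b by auto
      then obtain i j where ij: "b $ i $ j \<noteq> 0" by (auto simp: vec_eq_iff)
      have ne: "column j b \<noteq> 0" using ij by (auto simp: vec_eq_iff column_def)
      have "W *v column j b = column j (W ** b)" by (rule column_matrix_mult[symmetric])
      also have "\<dots> = ev b *\<^sub>R column j b"
        using B(4) b by (simp add: vec_eq_iff column_def)
      finally have eig: "W *v column j b = ev b *\<^sub>R column j b" .
      have "(mix_factor \<eta> (ev b) K)\<^sup>2 \<le> 2 * \<eta> ^ k"
        unfolding \<eta>_def k
        using weight_matrix_eigenvalue_bounds(1)[OF wm ne eig] l2(3)[OF ne eig False] l2(2)
        by (rule mix_factor_bound)
      also note rate
      finally show ?thesis unfolding power_mult_distrib by (rule mult_right_mono) simp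
    qed
  qed
  also have "\<dots> = (norm Y)\<^sup>2 / 1000" by (simp add: normY sum_divide_distrib)
  finally show ?thesis .
qed

lemma matrix_mult_consensus:
  assumes "weight_matrix adj W"
  shows "W ** consensus u = consensus u"
proof -
  have "W *v (\<chi> i. 1) = (\<chi> i. 1)" using assms by (simp add: weight_matrix_def)
  then have "(\<Sum>k\<in>UNIV. W $ i $ k) = 1" for i
    by (simp add: vec_eq_iff matrix_vector_mult_def)
  then show ?thesis
    by (simp add: vec_eq_iff[of "W ** consensus u"] matrix_mult_row flip: scaleR_sum_left)
qed

lemma fastmix_iter_diff_consensus:
  assumes "weight_matrix adj W"
  shows "fastmix_iter \<eta> W (X - consensus u) k = fastmix_iter \<eta> W X k - consensus u"
proof (induction k rule: induct_nat_012)
  case (ge2 k)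
  then show ?case
    by (simp only: fastmix_iter.simps linear_diff[OF linear_matrix_mult] matrix_mult_consensus[OF assms])
      (simp add: algebra_simps)
qed simp_all

lemma row_mean_matrix_mult:
  fixes X :: "real^'d^'m"
  assumes "weight_matrix adj W"
  shows "row_mean (W ** X) = row_mean X"
proof -
  have tr: "transpose W = W" using assms by (simp add: weight_matrix_def)
  have "real CARD('m) * (row_mean (W ** X) \<bullet> u) = real CARD('m) * (row_mean X \<bullet> u)" for u
    using symmetric_matrix_mult_inner[OF tr, of X "consensus u"]
    by (simp add: matrix_mult_consensus[OF assms] inner_consensus)
  then have "row_mean (W ** X) \<bullet> u = row_mean X \<bullet> u" for u by simp
  then show ?thesis by (intro vector_eq_rdot[THEN iffD1]) blast
qed

lemma row_mean_fastmix:
  assumes "weight_matrix adj W"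
  shows "row_mean (fastmix W K X) = row_mean X"
proof -
  have "row_mean (fastmix_iter \<eta> W X k) = row_mean X" for \<eta> k
    by (induction k rule: induct_nat_012)
      (simp_all add: row_mean_diff row_mean_scaleR row_mean_matrix_mult[OF assms] row_mean_add scaleR_add_left)
  then show ?thesis by (simp add: fastmix_def)
qed

lemma spread_fastmix:
  fixes W :: "real^'m^'m" and X :: "real^'d^'m"
  assumes wm: "weight_matrix adj W" and card: "CARD('m) \<ge> 2"
    and K: "15 / sqrt (1 - lambda2 W) \<le> real K"
  shows "(spread (fastmix W K X))\<^sup>2 \<le> (spread X)\<^sup>2 / 1000"
proof -
  have "fastmix W K X - consensus (row_mean (fastmix W K X)) = fastmix W K (X - consensus (row_mean X))"
    unfolding row_mean_fastmix[OF wm] by (simp add: fastmix_def fastmix_iter_diff_consensus[OF wm])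
  then show ?thesis
    unfolding spread_def
    using fastmix_contraction[OF wm card K, of "X - consensus (row_mean X)"]
    by (simp add: row_mean_diff)
qed


section \<open>Smooth and strongly convex functions, proximal maps\<close>

text \<open>
  Cocoercivity. The lower bound at \<open>x\<close> and the upper bound at \<open>y\<close> are compared at the point that one
  gradient step for the function \<open>f - gradient f x \<bullet> _\<close> reaches from \<open>y\<close>.
\<close>

lemma convex_smooth_lower:
  assumes cs: "convex_smooth L f" and L: "0 < L"
  shows "f x + gradient f x \<bullet> (y - x) + 1 / (2 * L) * (norm (gradient f y - gradient f x))\<^sup>2 \<le> f y"
proof -
  define d where "d = gradient f y - gradient f x"
  \<comment> \<open>the minimizer of the gap between the upper model at \<open>y\<close> and the lower model at \<open>x\<close>\<close>
  define z where "z = y - (1 / L) *\<^sub>R d"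
  have "f x + gradient f x \<bullet> (z - x) \<le> f z"
    and "f z \<le> f y + gradient f y \<bullet> (z - y) + L / 2 * (norm (y - z))\<^sup>2"
    using cs by (auto simp: convex_smooth_def)
  then have "f x + gradient f x \<bullet> (z - x) \<le> f y + gradient f y \<bullet> (z - y) + L / 2 * (norm (y - z))\<^sup>2"
    by linarith
  moreover have "gradient f x \<bullet> (z - x) = gradient f x \<bullet> (y - x) - (gradient f x \<bullet> d) / L"
    by (simp add: z_def inner_diff_right)
  moreover have "gradient f y \<bullet> (z - y) = - ((gradient f y \<bullet> d) / L)"
    by (simp add: z_def)
  moreover have "L / 2 * (norm (y - z))\<^sup>2 = 1 / (2 * L) * (norm d)\<^sup>2"
    using L by (simp add: z_def power_mult_distrib power_divide power2_eq_square)
  moreover have "(gradient f y \<bullet> d) / L - (gradient f x \<bullet> d) / L = 2 * (1 / (2 * L) * (norm d)\<^sup>2)"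
    by (simp add: d_def flip: diff_divide_distrib inner_diff_left power2_norm_eq_inner)
  ultimately show ?thesis unfolding d_def[symmetric] by linarith
qed

lemma convex_smooth_gradient_lipschitz:
  assumes cs: "convex_smooth L f" and L: "0 < L"
  shows "norm (gradient f y - gradient f x) \<le> L * norm (y - x)"
proof -
  let ?d = "gradient f y - gradient f x"
  have "1 / (2 * L) * (norm (gradient f x - gradient f y))\<^sup>2 = 1 / (2 * L) * (norm ?d)\<^sup>2"
    by (simp add: norm_minus_commute)
  moreover have "gradient f x \<bullet> (y - x) + gradient f y \<bullet> (x - y) = - (?d \<bullet> (y - x))"
    by (simp add: inner_diff_left inner_diff_right)
  moreover have "2 * (1 / (2 * L) * (norm ?d)\<^sup>2) = (norm ?d)\<^sup>2 / L" by simp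
  ultimately have "(norm ?d)\<^sup>2 / L \<le> ?d \<bullet> (y - x)"
    using convex_smooth_lower[OF assms, of x y] convex_smooth_lower[OF assms, of y x] by linarith
  also have "\<dots> \<le> norm ?d * norm (y - x)" by (rule norm_cauchy_schwarz)
  finally have "norm ?d * norm ?d \<le> norm ?d * (L * norm (y - x))"
    using L by (simp add: power2_eq_square field_simps)
  then show ?thesis
    using L by (cases "norm ?d = 0") (auto simp: mult_le_cancel_left)
qed

text \<open>
  On the unit ball \<open>g\<close> is bounded by continuity; along a ray, convexity prevents \<open>g\<close> from falling faster than
  linearly afterwards. This makes proximal problems coercive without an a priori subgradient of \<open>g\<close>.
\<close>

lemma convex_linear_lower_bound:
  fixes g :: "'a::euclidean_space \<Rightarrow> real"
  assumes cv: "convex_on UNIV g"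
  shows "\<exists>a\<ge>0. \<forall>x. g x \<ge> - a * (1 + norm x)"
proof -
  have "continuous_on UNIV g" by (rule convex_on_continuous[OF open_UNIV cv])
  then have "compact (g ` cball 0 1)"
    by (intro compact_continuous_image compact_cball) (auto intro: continuous_on_subset)
  then obtain M where "\<forall>y\<in>g ` cball 0 1. norm y \<le> M"
    using compact_imp_bounded bounded_iff by blast
  then have M: "\<bar>g x\<bar> \<le> M" if "norm x \<le> 1" for x using that by auto
  have M0: "0 \<le> M" using M[of 0] by simp
  have "g x \<ge> - (2 * M) * (1 + norm x)" for x
  proof (cases "norm x \<le> 1")
    case True
    then have "g x \<ge> - M" using M[of x] by linarith
    moreover have "M * 1 \<le> (2 * M) * (1 + norm x)" using M0 by (intro mult_mono) auto
    ultimately show ?thesis by simp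
  next
    case False
    define r where "r = norm x"
    have r: "1 < r" using False by (simp add: r_def)
    have "g ((1 - 1 / r) *\<^sub>R 0 + (1 / r) *\<^sub>R x) \<le> (1 - 1 / r) * g 0 + (1 / r) * g x"
      using r by (intro convex_onD[OF cv]) auto
    moreover have "norm ((1 / r) *\<^sub>R x) \<le> 1" using r by (simp add: r_def)
    ultimately have "- M \<le> (1 - 1 / r) * g 0 + (1 / r) * g x"
      using M[of "(1 / r) *\<^sub>R x"] by simp
    moreover have "(1 - 1 / r) * g 0 \<le> 1 * M"
      using M[of 0] r M0 by (intro order_trans[OF mult_left_mono[of "g 0" M]] mult_right_mono) auto
    ultimately have "- (2 * M) \<le> g x / r" by simp
    then have "- (2 * M) * r \<le> g x" using r by (simp add: field_simps)
    then show ?thesis using M0 by (simp add: r_def algebra_simps)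
  qed
  then show ?thesis using M0 by (intro exI[of _ "2 * M"]) auto
qed

lemma quadratic_growth_has_minimum:
  fixes h :: "'a::euclidean_space \<Rightarrow> real"
  assumes cont: "continuous_on UNIV h" and c: "0 < c"
    and growth: "\<And>x. h x \<ge> c * (norm x)\<^sup>2 - a * norm x - b"
  shows "\<exists>x. \<forall>y. h x \<le> h y"
proof -
  let ?S = "{x. h x \<le> h 0}"
  define R where "R = 1 + (\<bar>a\<bar> + \<bar>b\<bar> + \<bar>h 0\<bar>) / c"
  have "norm x \<le> R" if "h x \<le> h 0" for x
  proof (cases "norm x \<le> 1")
    case True
    moreover have "0 \<le> (\<bar>a\<bar> + \<bar>b\<bar> + \<bar>h 0\<bar>) / c" using c by simp
    ultimately show ?thesis unfolding R_def by linarith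
  next
    case False
    then have r: "1 < norm x" by simp
    have "c * (norm x)\<^sup>2 \<le> a * norm x + (b + h 0)" using growth[of x] that by linarith
    also have "\<dots> \<le> \<bar>a\<bar> * norm x + (\<bar>b\<bar> + \<bar>h 0\<bar>) * norm x"
    proof (rule add_mono)
      have "b + h 0 \<le> (\<bar>b\<bar> + \<bar>h 0\<bar>) * 1" by simp
      also have "\<dots> \<le> (\<bar>b\<bar> + \<bar>h 0\<bar>) * norm x" using r by (intro mult_left_mono) auto
      finally show "b + h 0 \<le> (\<bar>b\<bar> + \<bar>h 0\<bar>) * norm x" .
    qed (simp add: mult_right_mono)
    finally have "norm x * (c * norm x) \<le> norm x * (\<bar>a\<bar> + \<bar>b\<bar> + \<bar>h 0\<bar>)"
      by (simp add: power2_eq_square algebra_simps)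
    then have "c * norm x \<le> \<bar>a\<bar> + \<bar>b\<bar> + \<bar>h 0\<bar>"
      by (rule mult_left_le_imp_le) (use r in linarith)
    then have "norm x \<le> (\<bar>a\<bar> + \<bar>b\<bar> + \<bar>h 0\<bar>) / c" using c by (simp add: field_simps)
    then show ?thesis unfolding R_def by linarith
  qed
  then have "bounded ?S" by (auto simp: bounded_iff)
  moreover have "closed ?S"
    using cont by (intro closed_Collect_le) auto
  ultimately have "compact ?S" by (simp add: compact_eq_bounded_closed)
  moreover have "0 \<in> ?S" by simp
  ultimately obtain x where x: "x \<in> ?S" "\<And>y. y \<in> ?S \<Longrightarrow> h x \<le> h y"
    using continuous_attains_inf[of ?S h] continuous_on_subset[OF cont] by blast
  have "h x \<le> h y" for y
    using x(1) x(2)[of y] by (cases "y \<in> ?S") auto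
  then show ?thesis by blast
qed

lemma arg_min_le:
  fixes h :: "'a \<Rightarrow> real"
  assumes "\<exists>x. \<forall>y. h x \<le> h y"
  shows "h (ARG_MIN h w. True) \<le> h y"
proof -
  obtain x where "\<forall>y. h x \<le> h y" using assms by blast
  then have "is_arg_min h (\<lambda>_. True) x" by (auto simp: is_arg_min_def not_less)
  then have "is_arg_min h (\<lambda>_. True) (ARG_MIN h w. True)" unfolding arg_min_def by (rule someI)
  then show ?thesis by (auto simp: is_arg_min_def not_less)
qed

lemma nonneg_of_perturbations:
  fixes a b :: real
  assumes "\<And>t. 0 < t \<Longrightarrow> t \<le> 1 \<Longrightarrow> 0 \<le> a + t * b"
  shows "0 \<le> a"
proof (rule tendsto_lowerbound)
  have "((\<lambda>t. a + t * b) \<longlongrightarrow> a + 0 * b) (at_right 0)" by (intro tendsto_intros)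
  then show "((\<lambda>t. a + t * b) \<longlongrightarrow> a) (at_right 0)" by simp
  show "\<forall>\<^sub>F t in at_right 0. 0 \<le> a + t * b"
    unfolding eventually_at_right_field by (rule exI[of _ 1]) (auto intro: assms)
qed simp

text \<open>
  Optimality of \<open>w\<close> is tested along the segments from \<open>w\<close>, where the quadratic error of \<open>h\<close> is of second
  order. This provides a subgradient of \<open>g\<close> at exactly those points where the strong convexity
  inequality is going to be used.
\<close>

lemma minimizer_subgradient:
  fixes g h :: "real^'d \<Rightarrow> real"
  assumes cv: "convex_on UNIV g" and min: "\<And>u. h w + g w \<le> h u + g u"
    and quad: "\<And>u. h u \<le> h w + p \<bullet> (u - w) + C * (norm (u - w))\<^sup>2"
  shows "- p \<in> subdifferential g w"
proof -
  have "0 \<le> (p \<bullet> (u - w) + g u - g w) + t * (C * (norm (u - w))\<^sup>2)" if t: "0 < t" "t \<le> 1" for u t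
  proof -
    let ?v = "(1 - t) *\<^sub>R w + t *\<^sub>R u"
    have "g ?v \<le> (1 - t) * g w + t * g u" using t by (intro convex_onD[OF cv]) auto
    moreover have v: "?v - w = t *\<^sub>R (u - w)" by (simp add: algebra_simps)
    have "h ?v \<le> h w + t * (p \<bullet> (u - w)) + C * (t\<^sup>2 * (norm (u - w))\<^sup>2)"
      using quad[of ?v] unfolding v by (simp add: power_mult_distrib)
    ultimately have "0 \<le> t * (p \<bullet> (u - w)) + C * (t\<^sup>2 * (norm (u - w))\<^sup>2) + t * g u - t * g w"
      using min[of ?v] by (simp add: algebra_simps)
    also have "\<dots> = t * ((p \<bullet> (u - w) + g u - g w) + t * (C * (norm (u - w))\<^sup>2))"
      by (simp add: power2_eq_square algebra_simps)
    finally show ?thesis using t by (simp add: zero_le_mult_iff)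
  qed
  then have "0 \<le> p \<bullet> (u - w) + g u - g w" for u by (rule nonneg_of_perturbations)
  then have "g w + (- p) \<bullet> (u - w) \<le> g u" for u using inner_minus_left[of p "u - w"] by (smt (verit))
  then show ?thesis by (simp add: subdifferential_def)
qed

lemma norm_diff_power2_lower: "(norm x)\<^sup>2 - 2 * (norm v * norm x) \<le> (norm (x - v))\<^sup>2"
  for x v :: "'a::real_inner"
proof -
  have "(norm (x - v))\<^sup>2 = (norm x)\<^sup>2 - 2 * (v \<bullet> x) + (norm v)\<^sup>2"
    by (simp add: power2_norm_eq_inner inner_diff_left inner_diff_right inner_commute)
  then show ?thesis using norm_cauchy_schwarz[of v x] zero_le_power2[of "norm v"] by linarith
qed

lemma prox_minimizes:
  fixes g :: "real^'d \<Rightarrow> real"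
  assumes cv: "convex_on UNIV g" and \<gamma>: "0 < \<gamma>"
  shows "\<gamma> * g (prox \<gamma> g v) + 1 / 2 * (norm (prox \<gamma> g v - v))\<^sup>2 \<le> \<gamma> * g u + 1 / 2 * (norm (u - v))\<^sup>2"
proof -
  let ?h = "\<lambda>w. \<gamma> * g w + 1 / 2 * (norm (w - v))\<^sup>2"
  obtain a where a: "\<And>x. g x \<ge> - a * (1 + norm x)"
    using convex_linear_lower_bound[OF cv] by blast
  have cont: "continuous_on UNIV ?h"
    by (intro continuous_intros convex_on_continuous[OF open_UNIV cv])
  have growth: "1 / 2 * (norm x)\<^sup>2 - (\<gamma> * a + norm v) * norm x - \<gamma> * a \<le> ?h x" for x
  proof -
    have "\<gamma> * (- a * (1 + norm x)) \<le> \<gamma> * g x" using a \<gamma> by (intro mult_left_mono) auto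
    moreover have "(norm x)\<^sup>2 - 2 * (norm v * norm x) \<le> (norm (x - v))\<^sup>2"
      by (rule norm_diff_power2_lower)
    ultimately show ?thesis by (simp add: algebra_simps)
  qed
  have "\<exists>x. \<forall>y. ?h x \<le> ?h y"
    by (rule quadratic_growth_has_minimum[OF cont _ growth]) simp
  from arg_min_le[OF this] show ?thesis unfolding prox_def .
qed

lemma prox_subgradient:
  fixes g :: "real^'d \<Rightarrow> real"
  assumes cv: "convex_on UNIV g" and \<gamma>: "0 < \<gamma>"
  shows "(1 / \<gamma>) *\<^sub>R (v - prox \<gamma> g v) \<in> subdifferential g (prox \<gamma> g v)"
proof -
  define w where "w = prox \<gamma> g v"
  define h where "h u = 1 / (2 * \<gamma>) * (norm (u - v))\<^sup>2" for u
  have "- ((1 / \<gamma>) *\<^sub>R (w - v)) \<in> subdifferential g w"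
  proof (rule minimizer_subgradient[OF cv])
    fix u
    have "\<gamma> * (h w + g w) \<le> \<gamma> * (h u + g u)"
      using prox_minimizes[OF assms, of v u] \<gamma> by (simp add: h_def w_def distrib_left)
    then show "h w + g w \<le> h u + g u" using \<gamma> by (simp add: mult_le_cancel_left)
    have "(norm (u - v))\<^sup>2 = (norm (w - v))\<^sup>2 + 2 * ((w - v) \<bullet> (u - w)) + (norm (u - w))\<^sup>2"
      by (simp add: power2_norm_eq_inner inner_diff_left inner_diff_right inner_commute)
    then show "h u \<le> h w + ((1 / \<gamma>) *\<^sub>R (w - v)) \<bullet> (u - w) + 1 / (2 * \<gamma>) * (norm (u - w))\<^sup>2"
      unfolding inner_scaleR_left h_def using \<gamma> by (simp add: field_simps)
  qed
  moreover have "- ((1 / \<gamma>) *\<^sub>R (w - v)) = (1 / \<gamma>) *\<^sub>R (v - w)"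
    by (simp add: scaleR_diff_right)
  ultimately show ?thesis by (simp add: w_def)
qed

lemma prox_three_point:
  fixes g :: "real^'d \<Rightarrow> real" and v :: "real^'d"
  assumes sc: "strongly_convex \<mu> g" and \<gamma>: "0 < \<gamma>"
  defines "w \<equiv> prox \<gamma> g v"
  shows "\<gamma> * (g w - g u) \<le> (v - w) \<bullet> (w - u) - \<gamma> * \<mu> / 2 * (norm (w - u))\<^sup>2"
proof -
  have cv: "convex_on UNIV g" using sc by (simp add: strongly_convex_def)
  have "g w + ((1 / \<gamma>) *\<^sub>R (v - w)) \<bullet> (u - w) + \<mu> / 2 * (norm (u - w))\<^sup>2 \<le> g u"
    using sc prox_subgradient[OF cv \<gamma>, of v] unfolding strongly_convex_def w_def by blast
  then have "\<gamma> * (g w + ((1 / \<gamma>) *\<^sub>R (v - w)) \<bullet> (u - w) + \<mu> / 2 * (norm (u - w))\<^sup>2) \<le> \<gamma> * g u"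
    using \<gamma> by (intro mult_left_mono) auto
  moreover have "(v - w) \<bullet> (u - w) = - ((v - w) \<bullet> (w - u))" 
    by (metis inner_minus_right minus_diff_eq)
  moreover have "norm (u - w) = norm (w - u)" by (rule norm_minus_commute)
  ultimately show ?thesis using \<gamma> by (simp add: algebra_simps)
qed

text \<open>
  Monotonicity of the subdifferential, applied to the two subgradients from \<open>prox_subgradient\<close>.
\<close>

lemma prox_nonexpansive:
  fixes g :: "real^'d \<Rightarrow> real"
  assumes cv: "convex_on UNIV g" and \<gamma>: "0 < \<gamma>"
  shows "norm (prox \<gamma> g v - prox \<gamma> g v') \<le> norm (v - v')"
proof -
  define w w' where "w = prox \<gamma> g v" and "w' = prox \<gamma> g v'"
  have "g w + (1 / \<gamma>) * ((v - w) \<bullet> (w' - w)) \<le> g w'" "g w' + (1 / \<gamma>) * ((v' - w') \<bullet> (w - w')) \<le> g w"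
    using prox_subgradient[OF assms, of v] prox_subgradient[OF assms, of v']
    by (auto simp: subdifferential_def w_def w'_def)
  then have "(1 / \<gamma>) * ((v - w) \<bullet> (w' - w) + (v' - w') \<bullet> (w - w')) \<le> 0"
    by (simp only: distrib_left)
  then have "(v - w) \<bullet> (w' - w) + (v' - w') \<bullet> (w - w') \<le> 0"
    using \<gamma> by (simp add: divide_le_0_iff)
  then have "norm (w - w') * norm (w - w') \<le> (v - v') \<bullet> (w - w')"
    by (simp add: inner_diff_left inner_diff_right inner_commute flip: power2_eq_square power2_norm_eq_inner)
      (simp add: power2_norm_eq_inner inner_diff_left inner_diff_right inner_commute)
  also have "\<dots> \<le> norm (v - v') * norm (w - w')" by (rule norm_cauchy_schwarz)
  finally show ?thesis
    unfolding w_def[symmetric] w'_def[symmetric]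
    by (cases "norm (w - w') = 0") (auto simp: mult_le_cancel_right)
qed

lemma convex_smooth_continuous:
  assumes "convex_smooth L f"
  shows "continuous_on UNIV f"
proof (rule continuous_at_imp_continuous_on, rule ballI)
  fix x
  obtain D where "GDERIV f x :> D" using assms unfolding convex_smooth_def by blast
  then show "isCont f x" unfolding gderiv_def by (rule has_derivative_continuous)
qed

text \<open>
  The affine minorants of the \<open>f i\<close> at \<open>0\<close> and the quadratic minorant of \<open>g\<close> at a proximal point make the objective
  coercive, so that the minimum is attained and the choice made by \<open>ARG_MIN\<close> is a minimizer.
\<close>

lemma objective_minimizer:
  fixes f :: "'m::finite \<Rightarrow> real^'d \<Rightarrow> real" and g :: "real^'d \<Rightarrow> real"
  assumes fs: "\<And>i. convex_smooth L (f i)" and sc: "strongly_convex \<mu> g" and \<mu>: "0 < \<mu>"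
  shows "objective f g (ARG_MIN (objective f g) w. True) \<le> objective f g u"
proof (rule arg_min_le)
  have cv: "convex_on UNIV g" using sc by (simp add: strongly_convex_def)
  \<comment> \<open>any proximal point has an explicit subgradient\<close>
  define w v where "w = prox 1 g 0" and "v = (1 / 1) *\<^sub>R (0 - prox 1 g 0)"
  have g: "g w + v \<bullet> (x - w) + \<mu> / 2 * (norm (x - w))\<^sup>2 \<le> g x" for x
    using sc prox_subgradient[OF cv zero_less_one, of 0] unfolding strongly_convex_def w_def v_def by blast
  define p where "p = (1 / real CARD('m)) *\<^sub>R (\<Sum>i\<in>UNIV. gradient (f i) 0)"
  define q where "q = 1 / real CARD('m) * (\<Sum>i\<in>UNIV. f i 0)"
  have f: "q + p \<bullet> x \<le> 1 / real CARD('m) * (\<Sum>i\<in>UNIV. f i x)" for x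
  proof -
    have "f i 0 + gradient (f i) 0 \<bullet> (x - 0) \<le> f i x" for i
      using fs[of i] by (simp only: convex_smooth_def)
    then have "(\<Sum>i\<in>UNIV. f i 0 + gradient (f i) 0 \<bullet> x) \<le> (\<Sum>i\<in>UNIV. f i x)"
      by (intro sum_mono) simp
    then have "1 / real CARD('m) * (\<Sum>i\<in>UNIV. f i 0 + gradient (f i) 0 \<bullet> x) \<le> 1 / real CARD('m) * (\<Sum>i\<in>UNIV. f i x)"
      by (intro mult_left_mono) auto
    then show ?thesis
      by (simp add: q_def p_def sum.distrib inner_sum_left distrib_left)
  qed
  have cont: "continuous_on UNIV (objective f g)"
    unfolding objective_def
    by (intro continuous_intros convex_on_continuous[OF open_UNIV cv] convex_smooth_continuous[OF fs])
  show "\<exists>x. \<forall>y. objective f g x \<le> objective f g y"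
  proof (rule quadratic_growth_has_minimum[OF cont])
    show "0 < \<mu> / 2" using \<mu> by simp
    fix x
    have "- (norm p * norm x) \<le> p \<bullet> x" "- (norm v * norm x) \<le> v \<bullet> x"
      using Cauchy_Schwarz_ineq2[of p x] Cauchy_Schwarz_ineq2[of v x] by linarith+
    moreover have "(norm x)\<^sup>2 - 2 * (norm w * norm x) \<le> (norm (x - w))\<^sup>2"
      by (rule norm_diff_power2_lower)
    then have "\<mu> / 2 * ((norm x)\<^sup>2 - 2 * (norm w * norm x)) \<le> \<mu> / 2 * (norm (x - w))\<^sup>2"
      using \<mu> by (intro mult_left_mono) auto
    ultimately show "\<mu> / 2 * (norm x)\<^sup>2 - (norm p + norm v + \<mu> * norm w) * norm x - (v \<bullet> w - q - g w) \<le> objective f g x"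
      using f[of x] g[of x] by (simp add: objective_def inner_diff_right algebra_simps)
  qed
qed


section \<open>One step of the accelerated method\<close>

lemma grad_rows_nth [simp]: "grad_rows f X $ i = gradient (f i) (X $ i)"
  and prox_rows_nth [simp]: "prox_rows \<gamma> g X $ i = prox \<gamma> g (X $ i)"
  by (simp_all add: grad_rows_def prox_rows_def)

lemma norm_rows_mono:
  fixes X Y :: "real^'d^'m"
  assumes "\<And>i. norm (X $ i) \<le> c * norm (Y $ i)" and "0 \<le> c"
  shows "norm X \<le> c * norm Y"
proof (rule power2_le_imp_le)
  have "(norm (X $ i))\<^sup>2 \<le> c\<^sup>2 * (norm (Y $ i))\<^sup>2" for i
    using power_mono[OF assms(1)[of i], of 2] by (simp add: power_mult_distrib)
  then have "(norm X)\<^sup>2 \<le> (\<Sum>i\<in>UNIV. c\<^sup>2 * (norm (Y $ i))\<^sup>2)"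
    unfolding norm_matrix_power2 by (intro sum_mono) 
  then show "(norm X)\<^sup>2 \<le> (c * norm Y)\<^sup>2"
    by (simp add: norm_matrix_power2[of Y] power_mult_distrib sum_distrib_left)
qed (use assms(2) in simp)

lemma grad_rows_lipschitz:
  assumes "\<And>i. convex_smooth L (f i)" and "0 < L"
  shows "norm (grad_rows f X - grad_rows f Y) \<le> L * norm (X - Y)"
  by (rule norm_rows_mono) (use assms in \<open>auto intro: convex_smooth_gradient_lipschitz\<close>)

text \<open>
  The spread is the distance to the nearest matrix with equal rows, hence at most the distance to the
  proximal image of the mean.
\<close>

lemma spread_prox_rows:
  assumes cv: "convex_on UNIV g" and \<gamma>: "0 < \<gamma>"
  shows "spread (prox_rows \<gamma> g X) \<le> spread X"
proof -
  have "spread (prox_rows \<gamma> g X) \<le> norm (prox_rows \<gamma> g X - consensus (prox \<gamma> g (row_mean X)))"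
    by (rule spread_le_norm)
  also have "\<dots> \<le> 1 * norm (X - consensus (row_mean X))"
    by (rule norm_rows_mono) (use prox_nonexpansive[OF cv \<gamma>] in auto)
  finally show ?thesis by (simp add: spread_def)
qed

text \<open>
  Each agent linearizes its own function at its own point. The sum is the affine model of
  the sum of the \<open>f i\<close> that the network has access to; its slope is the mean of the local gradients.
\<close>

definition linearization :: "('m::finite \<Rightarrow> real^'d \<Rightarrow> real) \<Rightarrow> real^'d^'m \<Rightarrow> real^'d \<Rightarrow> real" where
  "linearization f X u = (\<Sum>i\<in>UNIV. f i (X $ i) + gradient (f i) (X $ i) \<bullet> (u - X $ i))"

lemma linearization_lower:
  assumes fs: "\<And>i. convex_smooth L (f i)" and L: "0 < L"
  shows "linearization f X u + 1 / (2 * L) * (norm (grad_rows f (consensus u) - grad_rows f X))\<^sup>2 \<le> (\<Sum>i\<in>UNIV. f i u)"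
proof -
  have "(\<Sum>i\<in>UNIV. f i (X $ i) + gradient (f i) (X $ i) \<bullet> (u - X $ i)
      + 1 / (2 * L) * (norm (gradient (f i) u - gradient (f i) (X $ i)))\<^sup>2) \<le> (\<Sum>i\<in>UNIV. f i u)"
    by (intro sum_mono convex_smooth_lower fs L)
  then show ?thesis
    by (simp add: linearization_def norm_matrix_power2 sum.distrib sum_divide_distrib)
qed

lemma linearization_upper:
  assumes fs: "\<And>i. convex_smooth L (f i)"
  shows "(\<Sum>i\<in>UNIV. f i u) \<le> linearization f X u + L / 2 * (norm (X - consensus u))\<^sup>2"
proof -
  have "f i u \<le> f i (X $ i) + gradient (f i) (X $ i) \<bullet> (u - X $ i) + L / 2 * (norm (X $ i - u))\<^sup>2" for i
    using fs[of i] unfolding convex_smooth_def by blast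
  then have "(\<Sum>i\<in>UNIV. f i u) \<le> (\<Sum>i\<in>UNIV. f i (X $ i) + gradient (f i) (X $ i) \<bullet> (u - X $ i)
      + L / 2 * (norm (X $ i - u))\<^sup>2)"
    by (intro sum_mono)
  then show ?thesis
    by (simp add: linearization_def norm_matrix_power2 sum.distrib sum_distrib_left sum_divide_distrib)
qed

lemma linearization_affine:
  fixes X :: "real^'d^'m"
  shows "linearization f X u = linearization f X v + real CARD('m) * (row_mean (grad_rows f X) \<bullet> (u - v))"
proof -
  have "linearization f X u - linearization f X v = (\<Sum>i\<in>UNIV. grad_rows f X $ i \<bullet> (u - v))"
    by (simp add: linearization_def inner_diff_right sum_subtractf[symmetric])
  also have "\<dots> = (\<Sum>i\<in>UNIV. grad_rows f X $ i) \<bullet> (u - v)" by (rule inner_sum_left[symmetric])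
  finally show ?thesis by (simp only: sum_rows inner_scaleR_left)
qed

lemma prox_rows_three_point:
  fixes Z S :: "real^'d^'m"
  assumes sc: "strongly_convex \<mu> g" and \<gamma>: "0 < \<gamma>"
  defines "P \<equiv> prox_rows \<gamma> g (Z - \<gamma> *\<^sub>R S)"
  shows "\<gamma> * ((\<Sum>i\<in>UNIV. g (P $ i)) - real CARD('m) * g u) + \<gamma> * (S \<bullet> (P - consensus u))
    \<le> 1 / 2 * (norm (Z - consensus u))\<^sup>2 - (1 + \<gamma> * \<mu>) / 2 * (norm (P - consensus u))\<^sup>2 - 1 / 2 * (norm (Z - P))\<^sup>2"
proof -
  have row: "\<gamma> * (g (P $ i) - g u) + \<gamma> * (S $ i \<bullet> (P $ i - u)) \<le> 1 / 2 * (norm (Z $ i - u))\<^sup>2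
      - (1 + \<gamma> * \<mu>) / 2 * (norm (P $ i - u))\<^sup>2 - 1 / 2 * (norm (Z $ i - P $ i))\<^sup>2" for i
  proof -
    let ?w = "P $ i"
    have w: "?w = prox \<gamma> g (Z $ i - \<gamma> *\<^sub>R S $ i)" by (simp add: P_def)
    have "\<gamma> * (g ?w - g u) \<le> (Z $ i - \<gamma> *\<^sub>R S $ i - ?w) \<bullet> (?w - u) - \<gamma> * \<mu> / 2 * (norm (?w - u))\<^sup>2"
      unfolding w by (rule prox_three_point[OF sc \<gamma>])
    moreover have "(Z $ i - \<gamma> *\<^sub>R S $ i - ?w) \<bullet> (?w - u) = (Z $ i - ?w) \<bullet> (?w - u) - \<gamma> * (S $ i \<bullet> (?w - u))"
      by (simp add: inner_diff_left)
    moreover have "(Z $ i - ?w) \<bullet> (?w - u)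
        = 1 / 2 * (norm (Z $ i - u))\<^sup>2 - 1 / 2 * (norm (?w - u))\<^sup>2 - 1 / 2 * (norm (Z $ i - ?w))\<^sup>2"
      by (simp add: power2_norm_eq_inner inner_diff_left inner_diff_right inner_commute) (simp add: field_simps)
    ultimately show ?thesis by (simp add: add_divide_distrib distrib_right)
  qed
  have "(\<Sum>i\<in>UNIV. \<gamma> * (g (P $ i) - g u) + \<gamma> * (S $ i \<bullet> (P $ i - u)))
      = \<gamma> * ((\<Sum>i\<in>UNIV. g (P $ i)) - real CARD('m) * g u) + \<gamma> * (S \<bullet> (P - consensus u))"
    by (simp add: sum.distrib sum_subtractf inner_vec_def[of S] flip: sum_distrib_left)
  moreover have "(\<Sum>i\<in>UNIV. 1 / 2 * (norm (Z $ i - u))\<^sup>2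
      - (1 + \<gamma> * \<mu>) / 2 * (norm (P $ i - u))\<^sup>2 - 1 / 2 * (norm (Z $ i - P $ i))\<^sup>2)
      = 1 / 2 * (norm (Z - consensus u))\<^sup>2 - (1 + \<gamma> * \<mu>) / 2 * (norm (P - consensus u))\<^sup>2 - 1 / 2 * (norm (Z - P))\<^sup>2"
    by (simp only: sum_subtractf norm_matrix_power2 sum_distrib_left vector_minus_component consensus_nth)
  moreover have "(\<Sum>i\<in>UNIV. \<gamma> * (g (P $ i) - g u) + \<gamma> * (S $ i \<bullet> (P $ i - u)))
      \<le> (\<Sum>i\<in>UNIV. 1 / 2 * (norm (Z $ i - u))\<^sup>2
      - (1 + \<gamma> * \<mu>) / 2 * (norm (P $ i - u))\<^sup>2 - 1 / 2 * (norm (Z $ i - P $ i))\<^sup>2)"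
    by (rule sum_mono) (rule row)
  ultimately show ?thesis by (simp only:)
qed

lemma convex_row_mean:
  fixes P :: "real^'d^'m"
  assumes "convex_on UNIV g"
  shows "real CARD('m) * g (row_mean P) \<le> (\<Sum>i\<in>UNIV. g (P $ i))"
proof -
  let ?m = "real CARD('m)"
  have "g (\<Sum>i\<in>UNIV. (1 / ?m) *\<^sub>R P $ i) \<le> (\<Sum>i\<in>UNIV. 1 / ?m * g (P $ i))"
    by (rule convex_on_sum[OF _ _ assms]) auto
  then have "g (row_mean P) \<le> 1 / ?m * (\<Sum>i\<in>UNIV. g (P $ i))"
    by (simp add: row_mean_def scaleR_sum_right sum_distrib_left)
  then have "?m * g (row_mean P) \<le> ?m * (1 / ?m * (\<Sum>i\<in>UNIV. g (P $ i)))"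
    by (rule mult_left_mono) simp
  then show ?thesis by simp
qed

lemma objective_times_card:
  fixes f :: "'m::finite \<Rightarrow> real^'d \<Rightarrow> real"
  shows "real CARD('m) * objective f g u = (\<Sum>i\<in>UNIV. f i u) + real CARD('m) * g u"
  by (simp add: objective_def distrib_left)

text \<open>
  The estimate-sequence argument for accelerated methods. The linearization is affine with slope given by
  the tracked gradient, so its value at the convex combination \<open>yb'\<close> splits into its values at \<open>yb\<close> and \<open>u\<close> plus
  an inner product, which the three-point inequality of the proximal step absorbs. The disagreement of
  the agents enters through \<open>spread X\<close> (upper model), \<open>spread Z\<close> (proximal step) and the product
  \<open>spread S * spread P\<close> (local versus averaged gradients). The last two summands are the negative terms that
  control the change of the gradients.
\<close>

lemma accelerated_descent:
  fixes f :: "'m::finite \<Rightarrow> real^'d \<Rightarrow> real" and S X Z :: "real^'d^'m" and yb u :: "real^'d"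
  assumes fs: "\<And>i. convex_smooth L (f i)" and sc: "strongly_convex \<mu> g"
    and pos: "0 < L" "0 < \<gamma>" "\<tau> = \<mu> * \<gamma>" "0 < \<tau>" "\<tau> \<le> 1"
    and X: "row_mean X = \<tau> *\<^sub>R row_mean Z + (1 - \<tau>) *\<^sub>R yb"
    and S: "row_mean S = row_mean (grad_rows f X)"
  defines "P \<equiv> prox_rows \<gamma> g (Z - \<gamma> *\<^sub>R S)"
  defines "yb' \<equiv> \<tau> *\<^sub>R row_mean P + (1 - \<tau>) *\<^sub>R yb" and "m \<equiv> real CARD('m)"
  shows "m * (objective f g yb' - objective f g u) + (1 + \<tau>) * \<mu> / 2 * (m * (norm (row_mean P - u))\<^sup>2)
    \<le> (1 - \<tau>) * (m * (objective f g yb - objective f g u)) + \<mu> / 2 * (m * (norm (row_mean Z - u))\<^sup>2)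
      + \<mu> / 2 * (spread Z)\<^sup>2 + L / 2 * (spread X)\<^sup>2
      + \<tau> * (spread S * spread P) - (1 + \<tau>) * \<mu> / 2 * (spread P)\<^sup>2
      - (\<mu> / 2 - L * \<tau>\<^sup>2 / 2) * (m * (norm (row_mean P - row_mean Z))\<^sup>2)
      - (1 - \<tau>) / (2 * L) * (norm (grad_rows f (consensus yb) - grad_rows f X))\<^sup>2"
proof -
  define sb zb zb' where "sb = row_mean S" and "zb = row_mean Z" and "zb' = row_mean P"
  define G where "G = (norm (grad_rows f (consensus yb) - grad_rows f X))\<^sup>2"
  define V where "V = m * (norm (zb' - zb))\<^sup>2"
  define D D' where "D = m * (norm (zb - u))\<^sup>2" and "D' = m * (norm (zb' - u))\<^sup>2"
  define sf where "sf v = (\<Sum>i\<in>UNIV. f i v)" for v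
  define l where "l = linearization f X"
  have cv: "convex_on UNIV g" using sc by (simp add: strongly_convex_def)
  have up: "sf yb' \<le> l yb' + L / 2 * (spread X)\<^sup>2 + L / 2 * (\<tau>\<^sup>2 * V)"
  proof -
    have "row_mean X - yb' = - (\<tau> *\<^sub>R (zb' - zb))"
      unfolding X yb'_def zb_def zb'_def by (simp add: algebra_simps)
    then have "(norm (row_mean X - yb'))\<^sup>2 = \<tau>\<^sup>2 * (norm (zb' - zb))\<^sup>2"
      by (simp add: power_mult_distrib)
    then have "(norm (X - consensus yb'))\<^sup>2 = (spread X)\<^sup>2 + \<tau>\<^sup>2 * V"
      by (simp add: bias_variance V_def m_def)
    then show ?thesis
      using linearization_upper[where f = f, OF fs, where u = yb' and X = X] by (simp add: sf_def l_def algebra_simps)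
  qed
  have aff: "l v = l u + m * (sb \<bullet> (v - u))" for v
    unfolding l_def m_def sb_def S by (rule linearization_affine)
  have "yb' - u = \<tau> *\<^sub>R (zb' - u) + (1 - \<tau>) *\<^sub>R (yb - u)"
    by (simp add: yb'_def zb'_def algebra_simps)
  then have lyb': "l yb' = \<tau> * l u + \<tau> * (m * (sb \<bullet> (zb' - u))) + (1 - \<tau>) * l yb"
    unfolding aff[of yb'] aff[of yb] by (simp add: inner_add_right) (simp add: algebra_simps)
  have "(1 - \<tau>) * (l yb + 1 / (2 * L) * G) \<le> (1 - \<tau>) * sf yb"
    using linearization_lower[where f = f, OF fs pos(1), where u = yb and X = X] pos
    by (intro mult_left_mono) (auto simp: l_def sf_def G_def)
  then have low1: "(1 - \<tau>) * l yb + (1 - \<tau>) / (2 * L) * G \<le> (1 - \<tau>) * sf yb"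
    by (simp add: distrib_left)
  have "0 \<le> 1 / (2 * L) * (norm (grad_rows f (consensus u) - grad_rows f X))\<^sup>2" using pos by simp
  then have "l u \<le> sf u"
    using linearization_lower[where f = f, OF fs pos(1), where u = u and X = X] by (simp add: l_def sf_def)
  then have low2: "\<tau> * l u \<le> \<tau> * sf u" using pos by (intro mult_left_mono) auto
  have "g yb' \<le> \<tau> * g zb' + (1 - \<tau>) * g yb"
    using convex_onD[OF cv, of \<tau> yb zb'] pos by (simp add: yb'_def zb'_def algebra_simps)
  then have "m * g yb' \<le> m * (\<tau> * g zb' + (1 - \<tau>) * g yb)" by (intro mult_left_mono) (auto simp: m_def)
  moreover have "\<tau> * (m * g zb') \<le> \<tau> * (\<Sum>i\<in>UNIV. g (P $ i))"
    using pos convex_row_mean[OF cv, of P] by (intro mult_left_mono) (auto simp: m_def zb'_def)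
  ultimately have gy: "m * g yb' \<le> \<tau> * (\<Sum>i\<in>UNIV. g (P $ i)) + (1 - \<tau>) * (m * g yb)"
    by (simp add: algebra_simps)
  have SP: "m * (sb \<bullet> (zb' - u)) - spread S * spread P \<le> S \<bullet> (P - consensus u)"
  proof -
    let ?A = "S - consensus sb" and ?B = "P - consensus zb'"
    have rA: "row_mean ?A = 0" and rB: "row_mean ?B = 0"
      by (simp_all add: row_mean_diff sb_def zb'_def)
    have "S \<bullet> (P - consensus u) = (?A + consensus sb) \<bullet> (?B + consensus (zb' - u))"
      by (simp add: consensus_diff)
    also have "\<dots> = ?A \<bullet> ?B + ?A \<bullet> consensus (zb' - u) + consensus sb \<bullet> ?B + consensus sb \<bullet> (consensus (zb' - u) :: real^'d^'m)"
      by (simp only: inner_add_left inner_add_right)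
    also have "?A \<bullet> consensus (zb' - u) = 0"
      unfolding inner_consensus rA by simp
    also have "consensus sb \<bullet> ?B = 0"
      unfolding inner_commute[of "consensus sb"] inner_consensus rB by simp
    also have "consensus sb \<bullet> (consensus (zb' - u) :: real^'d^'m) = m * (sb \<bullet> (zb' - u))"
      by (simp add: inner_consensus m_def)
    finally have "S \<bullet> (P - consensus u) = ?A \<bullet> ?B + m * (sb \<bullet> (zb' - u))" by simp
    moreover have "\<bar>?A \<bullet> ?B\<bar> \<le> spread S * spread P"
      unfolding spread_def sb_def zb'_def by (rule Cauchy_Schwarz_ineq2)
    ultimately show ?thesis by linarith
  qed
  have ZP: "V \<le> (norm (Z - P))\<^sup>2"
    using bias_variance[of "Z - P" 0]
    by (simp add: consensus_def zero_vec_def[symmetric] row_mean_diff V_def m_def zb_def zb'_def norm_minus_commute)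
  have "\<gamma> * ((\<Sum>i\<in>UNIV. g (P $ i)) - m * g u) + \<gamma> * (m * (sb \<bullet> (zb' - u)) - spread S * spread P)
    \<le> 1 / 2 * ((spread Z)\<^sup>2 + D) - (1 + \<tau>) / 2 * ((spread P)\<^sup>2 + D') - 1 / 2 * V"
  proof -
    have "\<gamma> * (m * (sb \<bullet> (zb' - u)) - spread S * spread P) \<le> \<gamma> * (S \<bullet> (P - consensus u))"
      using SP pos by (intro mult_left_mono) auto
    moreover have "\<gamma> * ((\<Sum>i\<in>UNIV. g (P $ i)) - m * g u) + \<gamma> * (S \<bullet> (P - consensus u))
      \<le> 1 / 2 * (norm (Z - consensus u))\<^sup>2 - (1 + \<gamma> * \<mu>) / 2 * (norm (P - consensus u))\<^sup>2 - 1 / 2 * (norm (Z - P))\<^sup>2"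
      unfolding P_def m_def by (rule prox_rows_three_point[OF sc pos(2)])
    moreover have "\<gamma> * \<mu> = \<tau>" using pos by simp
    ultimately show ?thesis
      using ZP by (simp add: bias_variance D_def D'_def m_def zb_def zb'_def)
  qed
  then have "\<mu> * (\<gamma> * ((\<Sum>i\<in>UNIV. g (P $ i)) - m * g u) + \<gamma> * (m * (sb \<bullet> (zb' - u)) - spread S * spread P))
    \<le> \<mu> * (1 / 2 * ((spread Z)\<^sup>2 + D) - (1 + \<tau>) / 2 * ((spread P)\<^sup>2 + D') - 1 / 2 * V)"
    using pos by (intro mult_left_mono) (auto simp: zero_less_mult_iff)
  moreover have "\<mu> * (\<gamma> * ((\<Sum>i\<in>UNIV. g (P $ i)) - m * g u) + \<gamma> * (m * (sb \<bullet> (zb' - u)) - spread S * spread P))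
    = \<tau> * (\<Sum>i\<in>UNIV. g (P $ i)) - \<tau> * (m * g u) + \<tau> * (m * (sb \<bullet> (zb' - u))) - \<tau> * (spread S * spread P)"
    unfolding pos(3) by (simp add: algebra_simps)
  moreover have "\<mu> * (1 / 2 * ((spread Z)\<^sup>2 + D) - (1 + \<tau>) / 2 * ((spread P)\<^sup>2 + D') - 1 / 2 * V)
    = \<mu> / 2 * (spread Z)\<^sup>2 + \<mu> / 2 * D - (1 + \<tau>) * \<mu> / 2 * (spread P)\<^sup>2 - (1 + \<tau>) * \<mu> / 2 * D' - \<mu> / 2 * V"
    by (simp add: field_simps)
  ultimately have prox: "\<tau> * (\<Sum>i\<in>UNIV. g (P $ i)) - \<tau> * (m * g u) + \<tau> * (m * (sb \<bullet> (zb' - u))) - \<tau> * (spread S * spread P)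
    \<le> \<mu> / 2 * (spread Z)\<^sup>2 + \<mu> / 2 * D - (1 + \<tau>) * \<mu> / 2 * (spread P)\<^sup>2 - (1 + \<tau>) * \<mu> / 2 * D' - \<mu> / 2 * V"
    by linarith
  have F: "m * (objective f g v - objective f g u) = sf v + m * g v - sf u - m * g u" for v
    unfolding right_diff_distrib m_def objective_times_card by (simp add: sf_def)
  have e1: "(1 - \<tau>) * (sf yb + m * g yb - sf u - m * g u)
      = (1 - \<tau>) * sf yb + (1 - \<tau>) * (m * g yb) - sf u + \<tau> * sf u - m * g u + \<tau> * (m * g u)"
    by (simp add: algebra_simps)
  have e2: "(\<mu> / 2 - L * \<tau>\<^sup>2 / 2) * V = \<mu> / 2 * V - L / 2 * (\<tau>\<^sup>2 * V)"
    by (simp add: algebra_simps)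
  show ?thesis
    unfolding F e1 V_def[symmetric] D_def[symmetric] D'_def[symmetric] G_def[symmetric]
      zb_def[symmetric] zb'_def[symmetric] 
    using e2 up lyb' low1 low2 gy prox by linarith
qed

text \<open>
  The unprimed and primed quantities are those before and after a step; \<open>a\<close>, \<open>b\<close>, \<open>e\<close>, \<open>h\<close> are the squared
  scaled spreads of \<open>z\<close>, \<open>y\<close>, \<open>s\<close>, \<open>x\<close>, while \<open>d\<close> and \<open>G\<close> are the squared terms that the descent estimate makes
  available with negative sign. The weights \<open>1 / 10\<close> and \<open>4 / 10\<close> are chosen so that
  \<open>h' \<le> 2 a + 2 b\<close>, the one bound without a small factor, costs less than the available weight of \<open>a\<close> and \<open>b\<close>, and
  that the weight of \<open>d'\<close> stays below \<open>49 / 100\<close>.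
\<close>

lemma lyapunov_arithmetic:
  fixes \<Psi> \<Psi>' a b e h d G a' b' e' h' d' \<tau> :: real
  assumes \<tau>: "0 < \<tau>" "\<tau> \<le> 1 / 20"
    and nn: "0 \<le> a" "0 \<le> b" "0 \<le> e" "0 \<le> h" "0 \<le> d" "0 \<le> G" "0 \<le> a'" "0 \<le> e'" "0 \<le> d'"
    and h': "h' \<le> 2 * a + 2 * b"
    and e': "e' \<le> 3 * (e + G + d + h) / 1000"
    and a': "a' \<le> 2 * (a + e') / 1000"
    and b': "b' \<le> 2 * (a' + b) / 1000"
    and \<Psi>': "\<Psi>' \<le> (1 - \<tau> / 2) * \<Psi> + a / 2 + e' / 2 + h' / 800 - 49 / 100 * d' - 190 * G"
  shows "\<Psi>' + a' + b' + e' + h' / 10 + 4 / 10 * d' \<le> (1 - \<tau> / 2) * (\<Psi> + a + b + e + h / 10 + 4 / 10 * d)"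
proof -
  \<comment> \<open>as \<open>\<tau> \<le> 1 / 20\<close>, the squared spreads may keep \<open>39 / 40\<close> of their weight\<close>
  define p q where "p = (1 - \<tau> / 2) * \<Psi>" and "q = (1 - \<tau> / 2) * (a + b + e + h / 10 + 4 / 10 * d)"
  have *: "39 / 40 * (a + b + e + h / 10 + 4 / 10 * d) \<le> q"
    unfolding q_def using nn \<tau> by (intro mult_right_mono) auto
  have "\<Psi>' + a' + b' + e' + h' / 10 + 4 / 10 * d' \<le> p + q"
  proof -
    have "a' + b' \<le> 3 / 1000 * a + 3 / 1000 * e' + 2 / 1000 * b"
      using a' b' nn by argo
    moreover have "\<Psi>' + h' / 10 + 4 / 10 * d' \<le> p + 71 / 100 * a + 21 / 100 * b + e' / 2 - 190 * G"
      using \<Psi>'[folded p_def] h' nn by argo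
    moreover have "(3 / 2 + 3 / 1000) * e' \<le> 5 / 1000 * (e + G + d + h)"
      using e' nn by argo
    ultimately show ?thesis using * nn by argo
  qed
  also have "p + q = (1 - \<tau> / 2) * (\<Psi> + a + b + e + h / 10 + 4 / 10 * d)"
    unfolding p_def q_def by (simp add: algebra_simps)
  finally show ?thesis .
qed


section \<open>Convergence of the coupled iteration\<close>

lemma square_sum2: "(p + q)\<^sup>2 \<le> 2 * p\<^sup>2 + 2 * q\<^sup>2" for p q :: real
  using zero_le_power2[of "p - q"] by (simp add: power2_eq_square algebra_simps)

lemma square_sum3: "(p + q + r)\<^sup>2 \<le> 3 * p\<^sup>2 + 3 * q\<^sup>2 + 3 * r\<^sup>2" for p q r :: real
  using zero_le_power2[of "p - q"] zero_le_power2[of "q - r"] zero_le_power2[of "p - r"]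
  by (simp add: power2_eq_square algebra_simps)

text \<open>
  A run of the algorithm together with a minimizer \<open>u\<close> of the objective.
\<close>

locale odapg =
  fixes f :: "'m::finite \<Rightarrow> real^'d \<Rightarrow> real" and g :: "real^'d \<Rightarrow> real"
    and adj :: "'m \<Rightarrow> 'm \<Rightarrow> bool" and W :: "real^'m^'m"
    and L \<mu> \<gamma> \<tau> :: real and K :: nat
    and x1 u :: "real^'d" and x s z y :: "nat \<Rightarrow> real^'d^'m"
  assumes card: "CARD('m) \<ge> 2"
    and wm: "weight_matrix adj W"
    and \<mu>: "0 < \<mu>" "\<mu> \<le> L"
    and fs: "\<And>i. convex_smooth L (f i)"
    and sc: "strongly_convex \<mu> g"
    and \<gamma>_def: "\<gamma> = 1 / (20 * sqrt (L * \<mu>))" and \<tau>_def: "\<tau> = \<mu> * \<gamma>"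
    and K: "15 / sqrt (1 - lambda2 W) \<le> real K"
    and run: "odapg_run f g W K (\<lambda>t. \<gamma>) (\<lambda>t. \<tau>) x1 x s z y"
    and min: "\<And>v. objective f g u \<le> objective f g v"
begin

lemma L: "0 < L" using \<mu> by linarith

lemma cv: "convex_on UNIV g" using sc by (simp add: strongly_convex_def)

lemma \<gamma>: "0 < \<gamma>" and \<gamma>2: "L * \<mu> * \<gamma>\<^sup>2 = 1 / 400"
  using L \<mu> by (simp_all add: \<gamma>_def power_divide power_mult_distrib)

lemma \<tau>: "0 < \<tau>" and L\<tau>2: "L * \<tau>\<^sup>2 = \<mu> / 400" and L\<gamma>\<tau>: "L * \<gamma> * \<tau> = 1 / 400"
proof -
  show "0 < \<tau>" using \<mu> \<gamma> by (simp add: \<tau>_def)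
  have "L * \<tau>\<^sup>2 = \<mu> * (L * \<mu> * \<gamma>\<^sup>2)" by (simp add: \<tau>_def power2_eq_square)
  then show "L * \<tau>\<^sup>2 = \<mu> / 400" unfolding \<gamma>2 by simp
  have "L * \<gamma> * \<tau> = L * \<mu> * \<gamma>\<^sup>2" by (simp add: \<tau>_def power2_eq_square)
  then show "L * \<gamma> * \<tau> = 1 / 400" unfolding \<gamma>2 by simp
qed

lemma \<tau>_le: "\<tau> \<le> 1 / 20"
proof (rule power2_le_imp_le)
  have "L * \<tau>\<^sup>2 \<le> L * (1 / 20)\<^sup>2" unfolding L\<tau>2 using \<mu> by (simp add: power2_eq_square)
  then show "\<tau>\<^sup>2 \<le> (1 / 20)\<^sup>2" by (rule mult_left_le_imp_le) (rule L)
qed simp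

lemma step_x: "t \<ge> 1 \<Longrightarrow> x (t + 1) = \<tau> *\<^sub>R z t + (1 - \<tau>) *\<^sub>R y t"
  and step_s: "t \<ge> 1 \<Longrightarrow> s (t + 1) = fastmix W K (s t + grad_rows f (x (t + 1)) - grad_rows f (x t))"
  and step_z: "t \<ge> 1 \<Longrightarrow> z (t + 1) = fastmix W K (prox_rows \<gamma> g (z t - \<gamma> *\<^sub>R s (t + 1)))"
  and step_y: "t \<ge> 1 \<Longrightarrow> y (t + 1) = fastmix W K (\<tau> *\<^sub>R z (t + 1) + (1 - \<tau>) *\<^sub>R y t)"
  and init_s: "s 1 = grad_rows f (x 1)"
  using run unfolding odapg_run_def by blast+

lemma gradient_tracking: "t \<ge> 1 \<Longrightarrow> row_mean (s t) = row_mean (grad_rows f (x t))"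
proof (induction t rule: dec_induct)
  case base
  then show ?case by (simp only: init_s)
next
  case (step n)
  then show ?case
    using step_s[of n] by (simp add: row_mean_fastmix[OF wm] row_mean_add row_mean_diff)
qed

definition proximal_point :: "nat \<Rightarrow> real^'d^'m" where
  "proximal_point t = prox_rows \<gamma> g (z t - \<gamma> *\<^sub>R s (t + 1))"

lemma row_mean_steps:
  assumes "t \<ge> 1"
  shows "row_mean (x (t + 1)) = \<tau> *\<^sub>R row_mean (z t) + (1 - \<tau>) *\<^sub>R row_mean (y t)"
    and "row_mean (z (t + 1)) = row_mean (proximal_point t)"
    and "row_mean (y (t + 1)) = \<tau> *\<^sub>R row_mean (z (t + 1)) + (1 - \<tau>) *\<^sub>R row_mean (y t)"
  using step_x[OF assms] step_z[OF assms] step_y[OF assms]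
  by (simp_all add: row_mean_fastmix[OF wm] row_mean_add row_mean_scaleR proximal_point_def)

text \<open>
  The means of \<open>y\<close> and \<open>x\<close> differ only by \<open>\<tau>\<close> times the last movement of the mean of \<open>z\<close>, which the descent
  estimate controls. This is why the change of the gradients is measured relative to \<open>y\<close>.
\<close>

lemma extrapolation_gap:
  assumes "t \<ge> 1"
  shows "row_mean (y (t + 1)) - row_mean (x (t + 1)) = \<tau> *\<^sub>R (row_mean (z (t + 1)) - row_mean (z t))"
  unfolding row_mean_steps(1,3)[OF assms] by (simp add: algebra_simps)

text \<open>
  The potential of the accelerated method, divided by \<open>\<mu>\<close> so that it has the dimension of a squared
  distance, like the spreads that it is going to be combined with. The factor \<open>m\<close> matches the Frobenius
  norm, which sums over the agents.
\<close>

definition objective_part :: "nat \<Rightarrow> real" where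
  "objective_part t = real CARD('m) * (objective f g (row_mean (y t)) - objective f g u) / \<mu>
     + (1 + \<tau>) / 2 * (real CARD('m) * (norm (row_mean (z t) - u))\<^sup>2)"

text \<open>
  Squared spreads in the scaling in which their mutual influence has numerical coefficients: \<open>x\<close> and \<open>y\<close>
  disagree by \<open>\<tau>\<close> times as much as \<open>z\<close>, and \<open>s\<close> acts on \<open>z\<close> through the step \<open>\<gamma> s\<close>.
\<close>

definition dz :: "nat \<Rightarrow> real" where "dz t = (spread (z t))\<^sup>2"
definition dy :: "nat \<Rightarrow> real" where "dy t = (spread (y t))\<^sup>2 / \<tau>\<^sup>2"
definition dx :: "nat \<Rightarrow> real" where "dx t = (spread (x t))\<^sup>2 / \<tau>\<^sup>2"
definition ds :: "nat \<Rightarrow> real" where "ds t = \<gamma>\<^sup>2 * (spread (s t))\<^sup>2"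
definition lag :: "nat \<Rightarrow> real" where
  "lag t = real CARD('m) * (norm (row_mean (y t) - row_mean (x t)))\<^sup>2 / \<tau>\<^sup>2"
definition grad_gap :: "nat \<Rightarrow> real" where
  "grad_gap t = \<gamma>\<^sup>2 * (norm (grad_rows f (consensus (row_mean (y t))) - grad_rows f (x (t + 1))))\<^sup>2"

definition lyapunov :: "nat \<Rightarrow> real" where
  "lyapunov t = objective_part t + dz t + dy t + ds t + dx t / 10 + 4 / 10 * lag t"

lemma objective_part_step:
  assumes t: "t \<ge> 1"
  shows "objective_part (t + 1) \<le> (1 - \<tau> / 2) * objective_part t + dz t / 2 + ds (t + 1) / 2
    + dx (t + 1) / 800 - 49 / 100 * lag (t + 1) - 190 * grad_gap t"
proof -
  define m where "m = real CARD('m)"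
  define gap where "gap k = m * (objective f g (row_mean (y k)) - objective f g u)" for k
  define D where "D k = m * (norm (row_mean (z k) - u))\<^sup>2" for k
  define q where "q = spread (proximal_point t)"
  define \<sigma> where "\<sigma> = spread (s (t + 1))"
  define Gn where "Gn = (norm (grad_rows f (consensus (row_mean (y t))) - grad_rows f (x (t + 1))))\<^sup>2"
  define V where "V = m * (norm (row_mean (z (t + 1)) - row_mean (z t)))\<^sup>2"
  have gap0: "0 \<le> gap k" and D0: "0 \<le> D k" for k
    using min by (auto simp: gap_def D_def m_def)
  have op: "\<mu> * objective_part k = gap k + (1 + \<tau>) * \<mu> / 2 * D k" for k
    using \<mu> by (simp add: objective_part_def gap_def D_def m_def field_simps)
  have lag: "lag (t + 1) = V"
    unfolding lag_def extrapolation_gap[OF t] using \<tau> by (simp add: V_def m_def power_mult_distrib)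
  have track: "row_mean (s (t + 1)) = row_mean (grad_rows f (x (t + 1)))"
    by (rule gradient_tracking) simp
  have "gap (t + 1) + (1 + \<tau>) * \<mu> / 2 * D (t + 1) \<le> (1 - \<tau>) * gap t + \<mu> / 2 * D t + \<mu> / 2 * (spread (z t))\<^sup>2
      + L / 2 * (spread (x (t + 1)))\<^sup>2 + \<tau> * (\<sigma> * q) - (1 + \<tau>) * \<mu> / 2 * q\<^sup>2
      - (\<mu> / 2 - L * \<tau>\<^sup>2 / 2) * V - (1 - \<tau>) / (2 * L) * Gn"
    using accelerated_descent[where f = f and u = u, OF fs sc L \<gamma> \<tau>_def \<tau> _ row_mean_steps(1)[OF t] track] \<tau>_le
    unfolding gap_def D_def q_def \<sigma>_def Gn_def V_def m_def row_mean_steps(3)[OF t] row_mean_steps(2)[OF t]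
      proximal_point_def by simp
  moreover have "(1 - \<tau>) * gap t \<le> (1 - \<tau> / 2) * gap t"
    using \<tau> gap0 by (intro mult_right_mono) auto
  moreover have "\<mu> / 2 * D t \<le> (1 - \<tau> / 2) * ((1 + \<tau>) * \<mu> / 2 * D t)"
  proof -
    have "0 \<le> \<tau> / 2 * (1 - \<tau>)" using \<tau> \<tau>_le by simp
    then have "1 \<le> (1 - \<tau> / 2) * (1 + \<tau>)" by (simp add: algebra_simps)
    then have "1 * (\<mu> / 2 * D t) \<le> (1 - \<tau> / 2) * (1 + \<tau>) * (\<mu> / 2 * D t)"
      using D0 \<mu> by (intro mult_right_mono) auto
    then show ?thesis by (simp add: mult.assoc)
  qed
  moreover have "L / 2 * (spread (x (t + 1)))\<^sup>2 = \<mu> * (dx (t + 1) / 800)"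
  proof -
    have "L / 2 * (spread (x (t + 1)))\<^sup>2 = (L * \<tau>\<^sup>2) / 2 * dx (t + 1)"
      using \<tau> by (simp add: dx_def)
    then show ?thesis unfolding L\<tau>2 by simp
  qed
  moreover have "\<tau> * (\<sigma> * q) - (1 + \<tau>) * \<mu> / 2 * q\<^sup>2 \<le> \<mu> * (ds (t + 1) / 2)"
  proof -
    \<comment> \<open>the strong convexity term \<open>\<mu> / 2 * q\<^sup>2\<close> of the proximal step absorbs the mixed term\<close>
    have "0 \<le> \<mu> * (\<gamma> * \<sigma> - q)\<^sup>2" using \<mu> by simp
    also have "\<dots> = 2 * (\<mu> * (ds (t + 1) / 2) - \<tau> * (\<sigma> * q) + \<mu> / 2 * q\<^sup>2)"
      by (simp add: ds_def \<sigma>_def \<tau>_def power2_eq_square algebra_simps)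
    finally have "\<tau> * (\<sigma> * q) - \<mu> / 2 * q\<^sup>2 \<le> \<mu> * (ds (t + 1) / 2)" by argo
    moreover have "1 * (\<mu> / 2 * q\<^sup>2) \<le> (1 + \<tau>) * (\<mu> / 2 * q\<^sup>2)"
      using \<tau> \<mu> by (intro mult_right_mono) auto
    ultimately show ?thesis by simp
  qed
  moreover have "\<mu> * (49 / 100 * V) \<le> (\<mu> / 2 - L * \<tau>\<^sup>2 / 2) * V"
  proof -
    have "(\<mu> * (49 / 100)) * V \<le> (\<mu> / 2 - L * \<tau>\<^sup>2 / 2) * V"
      unfolding L\<tau>2 using \<mu> by (intro mult_right_mono) (auto simp: V_def m_def)
    then show ?thesis by simp
  qed
  moreover have "\<mu> * (190 * grad_gap t) \<le> (1 - \<tau>) / (2 * L) * Gn"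
  proof -
    have c: "1 / (2 * L) = 200 * (\<mu> * \<gamma>\<^sup>2)"
      using \<gamma>2 L by (simp add: field_simps)
    have "(1 - \<tau>) / (2 * L) * Gn = (1 - \<tau>) * (1 / (2 * L) * Gn)" by simp
    also have "\<dots> = (1 - \<tau>) * (200 * \<mu> * grad_gap t)"
      unfolding c by (simp add: grad_gap_def Gn_def)
    finally have "(1 - \<tau>) / (2 * L) * Gn = (1 - \<tau>) * (200 * \<mu> * grad_gap t)" .
    moreover have "19 / 20 * (200 * \<mu> * grad_gap t) \<le> (1 - \<tau>) * (200 * \<mu> * grad_gap t)"
      using \<tau>_le \<mu> by (intro mult_right_mono) (auto simp: grad_gap_def)
    ultimately show ?thesis by simp
  qed
  ultimately have "\<mu> * objective_part (t + 1) \<le> (1 - \<tau> / 2) * gap t + (1 - \<tau> / 2) * ((1 + \<tau>) * \<mu> / 2 * D t)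
      + \<mu> / 2 * (spread (z t))\<^sup>2 + \<mu> * (dx (t + 1) / 800) + \<mu> * (ds (t + 1) / 2) - \<mu> * (49 / 100 * V) - \<mu> * (190 * grad_gap t)"
    unfolding op by linarith
  also have "(1 - \<tau> / 2) * gap t + (1 - \<tau> / 2) * ((1 + \<tau>) * \<mu> / 2 * D t) = (1 - \<tau> / 2) * (\<mu> * objective_part t)"
    unfolding op by (rule distrib_left[symmetric])
  also have "(1 - \<tau> / 2) * (\<mu> * objective_part t) + \<mu> / 2 * (spread (z t))\<^sup>2 + \<mu> * (dx (t + 1) / 800)
      + \<mu> * (ds (t + 1) / 2) - \<mu> * (49 / 100 * V) - \<mu> * (190 * grad_gap t)
    = \<mu> * ((1 - \<tau> / 2) * objective_part t + dz t / 2 + ds (t + 1) / 2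
      + dx (t + 1) / 800 - 49 / 100 * V - 190 * grad_gap t)"
    by (simp add: dz_def algebra_simps)
  finally show ?thesis
    unfolding lag by (rule mult_left_le_imp_le) (rule \<mu>)
qed

lemma spread_combination:
  "(spread (\<tau> *\<^sub>R X + (1 - \<tau>) *\<^sub>R Y))\<^sup>2 \<le> 2 * (\<tau>\<^sup>2 * (spread X)\<^sup>2) + 2 * (spread Y)\<^sup>2"
proof -
  have "spread (\<tau> *\<^sub>R X + (1 - \<tau>) *\<^sub>R Y) \<le> \<tau> * spread X + (1 - \<tau>) * spread Y"
    using spread_add[of "\<tau> *\<^sub>R X" "(1 - \<tau>) *\<^sub>R Y"] \<tau> \<tau>_le by (simp add: spread_scaleR)
  also have "\<dots> \<le> \<tau> * spread X + spread Y"
    using \<tau> by (simp add: mult_left_le_one_le algebra_simps)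
  finally have "(spread (\<tau> *\<^sub>R X + (1 - \<tau>) *\<^sub>R Y))\<^sup>2 \<le> (\<tau> * spread X + spread Y)\<^sup>2"
    by (intro power_mono) auto
  also have "\<dots> \<le> 2 * (\<tau> * spread X)\<^sup>2 + 2 * (spread Y)\<^sup>2" by (rule square_sum2)
  finally show ?thesis by (simp add: power_mult_distrib)
qed

lemma dx_step:
  assumes t: "t \<ge> 1"
  shows "dx (t + 1) \<le> 2 * dz t + 2 * dy t"
proof -
  have "(spread (x (t + 1)))\<^sup>2 \<le> 2 * (\<tau>\<^sup>2 * (spread (z t))\<^sup>2) + 2 * (spread (y t))\<^sup>2"
    unfolding step_x[OF t] by (rule spread_combination)
  then show ?thesis
    unfolding dx_def dy_def dz_def using \<tau> by (simp add: field_simps)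
qed

lemma dy_step:
  assumes t: "t \<ge> 1"
  shows "dy (t + 1) \<le> 2 * (dz (t + 1) + dy t) / 1000"
proof -
  have "(spread (y (t + 1)))\<^sup>2 \<le> (spread (\<tau> *\<^sub>R z (t + 1) + (1 - \<tau>) *\<^sub>R y t))\<^sup>2 / 1000"
    unfolding step_y[OF t] by (rule spread_fastmix[OF wm card K])
  also have "\<dots> \<le> (2 * (\<tau>\<^sup>2 * (spread (z (t + 1)))\<^sup>2) + 2 * (spread (y t))\<^sup>2) / 1000"
    by (intro divide_right_mono spread_combination) simp
  finally show ?thesis
    unfolding dy_def dz_def using \<tau> by (simp add: field_simps)
qed

lemma dz_step:
  assumes t: "t \<ge> 1"
  shows "dz (t + 1) \<le> 2 * (dz t + ds (t + 1)) / 1000"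
proof -
  have "spread (proximal_point t) \<le> spread (z t - \<gamma> *\<^sub>R s (t + 1))"
    unfolding proximal_point_def by (rule spread_prox_rows[OF cv \<gamma>])
  also have "\<dots> \<le> spread (z t) + \<gamma> * spread (s (t + 1))"
    using spread_add[of "z t" "(- \<gamma>) *\<^sub>R s (t + 1)"] \<gamma> by (simp add: spread_scaleR del: scaleR_minus_left) simp
  finally have "(spread (proximal_point t))\<^sup>2 \<le> (spread (z t) + \<gamma> * spread (s (t + 1)))\<^sup>2"
    by (intro power_mono) auto
  also have "\<dots> \<le> 2 * dz t + 2 * ds (t + 1)"
    unfolding dz_def ds_def using square_sum2[of "spread (z t)" "\<gamma> * spread (s (t + 1))"]
    by (simp add: power_mult_distrib)
  finally have "(spread (proximal_point t))\<^sup>2 / 1000 \<le> (2 * dz t + 2 * ds (t + 1)) / 1000"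
    by (rule divide_right_mono) simp
  moreover have "dz (t + 1) \<le> (spread (proximal_point t))\<^sup>2 / 1000"
    unfolding dz_def step_z[OF t] proximal_point_def by (rule spread_fastmix[OF wm card K])
  ultimately show ?thesis by simp
qed

text \<open>
  The gradients at two successive points are compared through the gradients at the mean of \<open>y\<close>. The newer
  difference is \<open>grad_gap\<close>, which is left to the descent estimate. The older one is estimated by the Lipschitz
  constant, as \<open>x\<close> deviates from the mean of \<open>y\<close> only by its spread and by \<open>lag\<close>.
\<close>

lemma ds_step:
  assumes t: "t \<ge> 1"
  shows "ds (t + 1) \<le> 3 * (ds t + grad_gap t + lag t + dx t) / 1000"
proof -
  let ?gy = "grad_rows f (consensus (row_mean (y t)))"
  define G where "G = norm (?gy - grad_rows f (x (t + 1)))"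
  define n where "n = norm (x t - consensus (row_mean (y t)))"
  have n2: "n\<^sup>2 = \<tau>\<^sup>2 * (dx t + lag t)"
    using \<tau> by (simp add: n_def bias_variance dx_def lag_def distrib_left norm_minus_commute)
  let ?Q = "grad_rows f (x (t + 1)) - grad_rows f (x t)"
  have "spread ?Q \<le> norm ?Q" using spread_le_norm[of ?Q 0] by (simp add: consensus_def zero_vec_def[symmetric])
  also have "?Q = (grad_rows f (x (t + 1)) - ?gy) + (?gy - grad_rows f (x t))" by simp
  also have "norm \<dots> \<le> G + norm (?gy - grad_rows f (x t))"
    unfolding G_def norm_minus_commute[of ?gy "grad_rows f (x (t + 1))"] by (rule norm_triangle_ineq)
  also have "norm (?gy - grad_rows f (x t)) \<le> L * n"
    unfolding n_def norm_minus_commute[of "x t"] by (rule grad_rows_lipschitz[where f = f, OF fs L])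
  finally have Q: "spread ?Q \<le> G + L * n" by simp
  have "spread (s t + ?Q) \<le> spread (s t) + (G + L * n)"
    using spread_add[of "s t" ?Q] Q by linarith
  then have "\<gamma> * spread (s t + ?Q) \<le> \<gamma> * (spread (s t) + (G + L * n))"
    using \<gamma> by (intro mult_left_mono) auto
  also have "\<dots> = \<gamma> * spread (s t) + \<gamma> * G + L * \<gamma> * n" by (simp add: algebra_simps)
  finally have "(\<gamma> * spread (s t + ?Q))\<^sup>2 \<le> (\<gamma> * spread (s t) + \<gamma> * G + L * \<gamma> * n)\<^sup>2"
    using \<gamma> by (intro power_mono) auto
  also have "\<dots> \<le> 3 * (\<gamma> * spread (s t))\<^sup>2 + 3 * (\<gamma> * G)\<^sup>2 + 3 * (L * \<gamma> * n)\<^sup>2"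
    by (rule square_sum3)
  also have "(L * \<gamma> * n)\<^sup>2 = (L * \<gamma> * \<tau>)\<^sup>2 * (dx t + lag t)"
    by (simp add: power_mult_distrib n2)
  also have "\<dots> \<le> 1 * (dx t + lag t)"
    unfolding L\<gamma>\<tau> by (intro mult_right_mono) (auto simp: power2_eq_square dx_def lag_def)
  finally have "(\<gamma> * spread (s t + ?Q))\<^sup>2 \<le> 3 * (ds t + grad_gap t + lag t + dx t)"
    by (simp add: ds_def grad_gap_def G_def power_mult_distrib)
  then have "(\<gamma> * spread (s t + ?Q))\<^sup>2 / 1000 \<le> 3 * (ds t + grad_gap t + lag t + dx t) / 1000"
    by (rule divide_right_mono) simp
  moreover have "ds (t + 1) \<le> (\<gamma> * spread (s t + ?Q))\<^sup>2 / 1000"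
  proof -
    have "s (t + 1) = fastmix W K (s t + ?Q)" unfolding step_s[OF t] by (simp add: add_diff_eq)
    then have "(spread (s (t + 1)))\<^sup>2 \<le> (spread (s t + ?Q))\<^sup>2 / 1000"
      using spread_fastmix[OF wm card K, of "s t + ?Q"] by simp
    then have "\<gamma>\<^sup>2 * (spread (s (t + 1)))\<^sup>2 \<le> \<gamma>\<^sup>2 * ((spread (s t + ?Q))\<^sup>2 / 1000)"
      by (rule mult_left_mono) simp
    then show ?thesis by (simp add: ds_def power_mult_distrib)
  qed
  ultimately show ?thesis by linarith
qed

lemma parts_nonneg: "0 \<le> dz t" "0 \<le> dy t" "0 \<le> ds t" "0 \<le> dx t" "0 \<le> lag t" "0 \<le> grad_gap t"
  by (simp_all add: dz_def dy_def ds_def dx_def lag_def grad_gap_def)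

lemma lyapunov_step:
  assumes t: "t \<ge> 1"
  shows "lyapunov (t + 1) \<le> (1 - \<tau> / 2) * lyapunov t"
  unfolding lyapunov_def
  by (rule lyapunov_arithmetic[OF \<tau> \<tau>_le _ _ _ _ _ _ _ _ _ dx_step[OF t] ds_step[OF t] dz_step[OF t]
        dy_step[OF t] objective_part_step[OF t]]) (rule parts_nonneg)+

lemma lyapunov_decay: "lyapunov (Suc n) \<le> (1 - \<tau> / 2) ^ n * lyapunov 1"
proof (induction n)
  case 0
  then show ?case by simp
next
  case (Suc n)
  have "lyapunov (Suc (Suc n)) \<le> (1 - \<tau> / 2) * lyapunov (Suc n)"
    using lyapunov_step[of "Suc n"] by simp
  also have "\<dots> \<le> (1 - \<tau> / 2) * ((1 - \<tau> / 2) ^ n * lyapunov 1)"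
    using Suc \<tau>_le by (intro mult_left_mono) auto
  finally show ?case by (simp add: mult_ac)
qed

text \<open>
  The squared distance of a single row is at most that of the whole matrix, which splits into the spread
  of \<open>z\<close> and the distance of its mean.
\<close>

lemma distance_le_lyapunov: "(norm (z t $ i - u))\<^sup>2 \<le> 2 * lyapunov t"
proof -
  define D where "D = real CARD('m) * (norm (row_mean (z t) - u))\<^sup>2"
  have D0: "0 \<le> D" by (simp add: D_def)
  have "norm ((z t - consensus u) $ i) \<le> norm (z t - consensus u)" by (rule Finite_Cartesian_Product.norm_nth_le)
  then have "(norm (z t $ i - u))\<^sup>2 \<le> (norm (z t - consensus u))\<^sup>2" by (intro power_mono) auto
  also have "\<dots> = dz t + D" by (simp add: bias_variance dz_def D_def)
  also have "\<dots> \<le> 2 * lyapunov t"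
  proof -
    have "0 \<le> real CARD('m) * (objective f g (row_mean (y t)) - objective f g u) / \<mu>"
      using min \<mu> by (intro divide_nonneg_pos mult_nonneg_nonneg) auto
    moreover have "D / 2 \<le> (1 + \<tau>) / 2 * D" using \<tau> D0 by (simp add: distrib_right)
    ultimately have "D / 2 \<le> objective_part t" unfolding objective_part_def D_def by linarith
    then show ?thesis unfolding lyapunov_def using parts_nonneg[of t] by argo
  qed
  finally show ?thesis .
qed

lemma linear_convergence:
  "(norm (z (Suc n) $ i - u))\<^sup>2 \<le> exp (- (real n * \<tau> / 2)) * (2 * lyapunov 1)"
proof -
  have "0 \<le> 2 * lyapunov 1"
    using distance_le_lyapunov[of 1 undefined] by (rule order_trans[rotated]) simp
  moreover have "(1 - \<tau> / 2) ^ n \<le> exp (- (real n * \<tau> / 2))"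
  proof -
    have "1 - \<tau> / 2 \<le> exp (- (\<tau> / 2))" using exp_ge_add_one_self[of "- (\<tau> / 2)"] by simp
    then have "(1 - \<tau> / 2) ^ n \<le> exp (- (\<tau> / 2)) ^ n" using \<tau>_le by (intro power_mono) auto
    then show ?thesis by (simp flip: exp_of_nat_mult)
  qed
  ultimately have "(1 - \<tau> / 2) ^ n * (2 * lyapunov 1) \<le> exp (- (real n * \<tau> / 2)) * (2 * lyapunov 1)"
    by (intro mult_right_mono)
  moreover have "(norm (z (Suc n) $ i - u))\<^sup>2 \<le> 2 * lyapunov (Suc n)" by (rule distance_le_lyapunov)
  ultimately show ?thesis using lyapunov_decay[of n] by simp
qed

end


section \<open>Iteration and communication counts\<close>

text \<open>
  For \<open>\<epsilon> < 1 / (C + 1)\<close> the term \<open>ln (C + 1)\<close> is below \<open>ln (1 / \<epsilon>)\<close>. Doubling the leading \<open>40 \<kappa> ln (1 / \<epsilon>)\<close>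
  therefore pays for the initial error \<open>C\<close>, and rounding costs at most \<open>2 \<le> 2 \<kappa> ln (1 / \<epsilon>)\<close>.
\<close>

lemma exponential_decay_iterations:
  fixes d :: "nat \<Rightarrow> 'i \<Rightarrow> real" and \<kappa> C :: real
  assumes \<kappa>: "1 \<le> \<kappa>" and C: "0 \<le> C"
    and decay: "\<And>n i. d (Suc n) i \<le> exp (- (real n / (40 * \<kappa>))) * C"
  shows "\<forall>\<^sub>F \<epsilon> in at_right 0. \<exists>T\<ge>1. real T \<le> 82 * (\<kappa> * ln (1 / \<epsilon>)) \<and> (\<forall>n\<ge>T. \<forall>i. d n i \<le> \<epsilon>)"
  unfolding eventually_at_right_field
proof (intro exI[of _ "min (exp (- 1)) (1 / (C + 1))"] conjI allI impI)
  show "0 < min (exp (- 1)) (1 / (C + 1))" using C by simp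
  fix \<epsilon> :: real
  assume \<epsilon>: "0 < \<epsilon>" and "\<epsilon> < min (exp (- 1)) (1 / (C + 1))"
  then have \<epsilon>1: "\<epsilon> \<le> exp (- 1)" and \<epsilon>C: "\<epsilon> < 1 / (C + 1)" by auto
  define l where "l = ln (1 / \<epsilon>)"
  have l: "l = - ln \<epsilon>" using \<epsilon> by (simp add: l_def ln_div)
  have "ln \<epsilon> \<le> ln (exp (- 1))" using \<epsilon> \<epsilon>1 by (subst ln_le_cancel_iff) auto
  then have "ln \<epsilon> \<le> - 1" by simp
  then have l1: "1 \<le> l" by (simp add: l)
  have kl: "1 \<le> \<kappa> * l" using mult_mono[OF \<kappa> l1] \<kappa> by simp
  define T where "T = Suc (nat \<lceil>80 * (\<kappa> * l)\<rceil>)"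
  have "real (nat \<lceil>80 * (\<kappa> * l)\<rceil>) \<le> 80 * (\<kappa> * l) + 1"
    using kl by (simp add: of_nat_nat)
  moreover have "real T = real (nat \<lceil>80 * (\<kappa> * l)\<rceil>) + 1" by (simp add: T_def)
  ultimately have "real T \<le> 82 * (\<kappa> * l)" using kl by argo
  then have T: "real T \<le> 82 * (\<kappa> * ln (1 / \<epsilon>))" by (simp only: l_def)
  have "d n i \<le> \<epsilon>" if "n \<ge> T" for n i
  proof -
    have "0 < n" using that by (simp add: T_def)
    then obtain k where k: "n = Suc k" using gr0_implies_Suc by blast
    have "80 * (\<kappa> * l) \<le> real k"
      using that unfolding k T_def by simp
    then have "2 * l \<le> real k / (40 * \<kappa>)" using \<kappa> by (simp add: field_simps)
    then have "exp (- (real k / (40 * \<kappa>))) \<le> exp (- (2 * l))" by simp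
    also have "- (2 * l) = ln \<epsilon> + ln \<epsilon>" by (simp add: l)
    also have "exp (ln \<epsilon> + ln \<epsilon>) = \<epsilon> * \<epsilon>" unfolding exp_add using \<epsilon> by simp
    finally have "exp (- (real k / (40 * \<kappa>))) * C \<le> \<epsilon> * \<epsilon> * C" using C by (rule mult_right_mono)
    also have "\<dots> = \<epsilon> * (\<epsilon> * C)" by simp
    also have "\<dots> \<le> \<epsilon> * 1"
    proof (rule mult_left_mono)
      have "\<epsilon> * (C + 1) \<le> 1" using \<epsilon>C C by (simp add: field_simps)
      then show "\<epsilon> * C \<le> 1" using \<epsilon> by (simp add: distrib_left)
    qed (use \<epsilon> in simp)
    finally show ?thesis using decay[of k i] unfolding k by simp
  qed
  with T show "\<exists>T\<ge>1. real T \<le> 82 * (\<kappa> * ln (1 / \<epsilon>)) \<and> (\<forall>n\<ge>T. \<forall>i. d n i \<le> \<epsilon>)"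
    by (intro exI[of _ T]) (auto simp: T_def)
qed

theorem corollary2:
  fixes f :: "'m::finite \<Rightarrow> real^'d \<Rightarrow> real" and g :: "real^'d \<Rightarrow> real"
    and adj :: "'m \<Rightarrow> 'm \<Rightarrow> bool" and W :: "real^'m^'m"
    and L \<mu> \<gamma> \<tau> :: real and K :: nat
    and x1 xstar :: "real^'d" and x s z y :: "nat \<Rightarrow> real^'d^'m"
  assumes "CARD('m) \<ge> 2"
    and "connected_network adj" and "weight_matrix adj W"
    and "0 < \<mu>" and "\<mu> \<le> L"
    and "\<And>i. convex_smooth L (f i)"
    and "strongly_convex \<mu> g"
    and "\<gamma> = 1 / (20 * sqrt (L * \<mu>))" and "\<tau> = \<mu> * \<gamma>"
    and "K = nat \<lceil>15 / sqrt (1 - lambda2 W)\<rceil>"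
    and "odapg_run f g W K (\<lambda>t. \<gamma>) (\<lambda>t. \<tau>) x1 x s z y"
    and "xstar = (ARG_MIN (objective f g) w. True)"
  shows "\<forall>\<^sub>F \<epsilon> in at_right 0. \<exists>T\<ge>1.
           real T \<le> universal_const * (sqrt (L / \<mu>) * ln (1 / \<epsilon>)) \<and>
           real (3 * T * K) \<le> universal_const * (sqrt (L / (\<mu> * (1 - lambda2 W))) * ln (1 / \<epsilon>)) \<and>
           (\<forall>n\<ge>T. \<forall>i. (norm (z n $ i - xstar))\<^sup>2 \<le> \<epsilon>)"
proof -
  note l2 = lambda2_weight_matrix[OF assms(3,1)]
  define r where "r = sqrt (1 - lambda2 W)"
  have r: "0 < r" "r \<le> 1" using l2(1,2) by (auto simp: r_def)
  have K_lower: "15 / sqrt (1 - lambda2 W) \<le> real K"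
    unfolding assms(10) by (rule real_nat_ceiling_ge)
  have "0 < 15 / r" using r by simp
  then have "real K \<le> 15 / r + 1"
    unfolding assms(10) r_def[symmetric] by (simp add: of_nat_nat)
  also have "\<dots> \<le> 16 / r" using r by (simp add: field_simps)
  finally have K_upper: "real K \<le> 16 / r" .
  interpret odapg f g adj W L \<mu> \<gamma> \<tau> K x1 xstar x s z y
  proof unfold_locales
    show "objective f g xstar \<le> objective f g v" for v
      unfolding assms(12) by (rule objective_minimizer[OF assms(6,7,4)])
  qed (use assms K_lower in auto)
  define \<kappa> where "\<kappa> = sqrt (L / \<mu>)"
  have \<kappa>1: "1 \<le> \<kappa>" using assms(4,5) by (simp add: \<kappa>_def)
  have "\<tau> = 1 / (20 * \<kappa>)"
  proof -
    have "\<kappa> * \<tau> = sqrt L * sqrt \<mu> / (20 * (sqrt L * sqrt \<mu>))"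
      using \<mu> by (simp add: \<kappa>_def \<tau>_def \<gamma>_def real_sqrt_divide real_sqrt_mult field_simps flip: power2_eq_square)
    also have "\<dots> = 1 / 20" using \<mu> L by simp
    finally show ?thesis using \<kappa>1 by (simp add: field_simps)
  qed
  then have "(norm (z (Suc n) $ i - xstar))\<^sup>2 \<le> exp (- (real n / (40 * \<kappa>))) * (2 * lyapunov 1)" for n i
    using linear_convergence[of n i] by simp
  moreover have "0 \<le> 2 * lyapunov 1"
    using distance_le_lyapunov[of 1 undefined] by (rule order_trans[rotated]) simp
  ultimately have "\<forall>\<^sub>F \<epsilon> in at_right 0. \<exists>T\<ge>1. real T \<le> 82 * (\<kappa> * ln (1 / \<epsilon>)) \<and>
      (\<forall>n\<ge>T. \<forall>i. (norm (z n $ i - xstar))\<^sup>2 \<le> \<epsilon>)"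
    by (intro exponential_decay_iterations[OF \<kappa>1])
  then show ?thesis
  proof (rule eventually_mono)
    fix \<epsilon> :: real
    assume "\<exists>T\<ge>1. real T \<le> 82 * (\<kappa> * ln (1 / \<epsilon>)) \<and> (\<forall>n\<ge>T. \<forall>i. (norm (z n $ i - xstar))\<^sup>2 \<le> \<epsilon>)"
    then obtain T where T: "T \<ge> 1" "real T \<le> 82 * (\<kappa> * ln (1 / \<epsilon>))"
      "\<forall>n\<ge>T. \<forall>i. (norm (z n $ i - xstar))\<^sup>2 \<le> \<epsilon>" by blast
    have nn: "0 \<le> \<kappa> * ln (1 / \<epsilon>)" using T(2) by linarith
    have "real T \<le> universal_const * (\<kappa> * ln (1 / \<epsilon>))"
      using T(2) nn by (simp add: universal_const_def)
    moreover have "real (3 * T * K) \<le> universal_const * (sqrt (L / (\<mu> * (1 - lambda2 W))) * ln (1 / \<epsilon>))"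
    proof -
      have "real (3 * T * K) = 3 * (real T * real K)" by simp
      also have "\<dots> \<le> 3 * (82 * (\<kappa> * ln (1 / \<epsilon>)) * (16 / r))"
        using T(2) K_upper nn by (intro mult_left_mono mult_mono) auto
      also have "\<dots> = 3936 * (\<kappa> * ln (1 / \<epsilon>) / r)" by simp
      also have "\<dots> \<le> universal_const * (\<kappa> * ln (1 / \<epsilon>) / r)"
        using nn r by (intro mult_right_mono) (auto simp: universal_const_def)
      also have "\<kappa> * ln (1 / \<epsilon>) / r = sqrt (L / (\<mu> * (1 - lambda2 W))) * ln (1 / \<epsilon>)"
        by (simp add: \<kappa>_def r_def real_sqrt_divide real_sqrt_mult)
      finally show ?thesis .
    qed
    ultimately show "\<exists>T\<ge>1. real T \<le> universal_const * (sqrt (L / \<mu>) * ln (1 / \<epsilon>)) \<and>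
           real (3 * T * K) \<le> universal_const * (sqrt (L / (\<mu> * (1 - lambda2 W))) * ln (1 / \<epsilon>)) \<and>
           (\<forall>n\<ge>T. \<forall>i. (norm (z n $ i - xstar))\<^sup>2 \<le> \<epsilon>)"
      using T(1,3) unfolding \<kappa>_def by blast
  qed
qed

end
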